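(* Assume the standing setup below and additionally that every $\ell\in\mathcal{F}$ is $L$-Lipschitz: $\ell(z')-\ell(z)\le L\,d(z,z')$ for all $z,z'\in\mathcal{Z}$. Let $\hat\ell\in\arg\min_{\ell\in\mathcal{F}}R_{\mathbb{P}_N,\alpha,2}(\ell)$ and assume $R^*_{\mathbb{P},\alpha,2}(\mathcal{F})=\inf_{\ell\in\mathcal{F}}R_{\mathbb{P},\alpha,2}(\ell)$ is attained by some $\ell^*\in\mathcal{F}$. Then for every $\eta\in(0,1)$, with probability at least $1-\eta$, $$R_{\mathbb{P},\alpha,2}(\hat\ell)-R^*_{\mathbb{P},\alpha,2}(\mathcal{F})\le\frac{48\,\mathcal{J}(\mathcal{F})}{\sqrt N}+\frac{48\,L\,[\mathrm{diam}(\mathcal{Z})]^2}{\alpha\sqrt N}+3B\sqrt{\frac{\log(2/\eta)}{2N}}.$$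
   Context: Standing setup: $(\mathcal{Z},d)$ is a Polish metric space with finite diameter $\mathrm{diam}(\mathcal{Z})=\sup_{z,z'}d(z,z')<\infty$. $\mathcal{F}$ is a class of upper semicontinuous functions $\ell:\mathcal{Z}\to[0,B]$, $B<\infty$ (the paper's statement is written for $B=1$, the sum-of-squares pairwise ranking loss), and all suprema over $\mathcal{F}$ are assumed measurable. $z_1,\dots,z_N$ are i.i.d. with law $\mathbb{P}$ and $\mathbb{P}_N=\frac1N\sum_i\delta_{z_i}$. The $2$-Wasserstein distance is $\mathcal{W}_2(\mathbb{P},\mathbb{Q})=\big(\inf_{\gamma\in\Gamma(\mathbb{P},\mathbb{Q})}\int d(z,z')^2d\gamma\big)^{1/2}$; $\mathfrak{W}^\alpha_2(\mathbb{P})=\{\mathbb{Q}:\mathcal{W}_2(\mathbb{P},\mathbb{Q})\le\alpha\}$ with $\alpha>0$; $R_{\mathbb{P},\alpha,2}(\ell)=\sup_{\mathbb{Q}\in\mathfrak{W}^\alpha_2(\mathbb{P})}\int\ell\,d\mathbb{Q}$ (likewise for $\mathbb{P}_N$). Dudley's entropy integral is $\mathcal{J}(\mathcal{F})=\int_0^\infty\sqrt{\log\mathfrak{N}(\mathcal{F},\|\cdot\|_\infty,\upsilon)}\,d\upsilon$, with $\mathfrak{N}(\mathcal{F},\|\cdot\|_\infty,\upsilon)$ the minimal size of a $\upsilon$-cover of $\mathcal{F}$ in the uniform norm by elements of $\mathcal{F}$; assume $\mathcal{J}(\mathcal{F})<\infty$. *)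

theory Defs
  imports "HOL-Probability.Probability"
begin

definition usc :: "('a::topological_space \<Rightarrow> real) \<Rightarrow> bool" where
  "usc f \<longleftrightarrow> (\<forall>x t. f x < t \<longrightarrow> eventually (\<lambda>y. f y < t) (nhds x))"

definition couplings :: "'z::metric_space measure \<Rightarrow> 'z measure \<Rightarrow> ('z \<times> 'z) measure set" where
  "couplings P Q = {\<gamma>. sets \<gamma> = sets (borel \<Otimes>\<^sub>M borel) \<and> prob_space \<gamma>
      \<and> distr \<gamma> borel fst = P \<and> distr \<gamma> borel snd = Q}"

definition W2 :: "'z::metric_space measure \<Rightarrow> 'z measure \<Rightarrow> real" where
  "W2 P Q = sqrt (Inf ((\<lambda>\<gamma>. \<integral>p. (dist (fst p) (snd p))\<^sup>2 \<partial>\<gamma>) ` couplings P Q))"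

definition borel_probs :: "'z::topological_space measure set" where
  "borel_probs = {Q. sets Q = sets borel \<and> prob_space Q}"

definition WRisk :: "'z::metric_space measure \<Rightarrow> real \<Rightarrow> ('z \<Rightarrow> real) \<Rightarrow> real" where
  "WRisk P \<alpha> l = Sup ((\<lambda>Q. \<integral>z. l z \<partial>Q) ` {Q \<in> borel_probs. W2 P Q \<le> \<alpha>})"

definition empirical :: "nat \<Rightarrow> (nat \<Rightarrow> 'z::topological_space) \<Rightarrow> 'z measure" where
  "empirical N \<omega> = distr (uniform_measure (count_space {..<N}) {..<N}) borel \<omega>"

text \<open>Covering number of F in the uniform norm at scale v, by elements of F (infinity if no finite cover).\<close>
definition cover_num :: "('z \<Rightarrow> real) set \<Rightarrow> real \<Rightarrow> enat" where
  "cover_num F v = Inf {enat (card C) | C. finite C \<and> C \<subseteq> F \<and>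
      (\<forall>l\<in>F. \<exists>c\<in>C. (SUP z. \<bar>l z - c z\<bar>) \<le> v)}"

definition entropy :: "('z \<Rightarrow> real) set \<Rightarrow> real \<Rightarrow> ennreal" where
  "entropy F v = (case cover_num F v of enat n \<Rightarrow> ennreal (sqrt (ln (real n))) | \<infinity> \<Rightarrow> \<infinity>)"

definition dudley :: "('z \<Rightarrow> real) set \<Rightarrow> ennreal" where
  "dudley F = (\<integral>\<^sup>+ v. entropy F v * indicator {0<..} v \<partial>lborel)"

end

theory Submission
  imports Defs
begin

text \<open>
  By Lagrangian duality the worst-case risk of \<open>l\<close> over the Wasserstein ball is
  \<open>min\<^sub>\<kappa> (\<kappa> \<alpha>\<^sup>2 + E \<phi>\<^sub>\<kappa>\<^sub>,\<^sub>l)\<close> with \<open>\<phi>\<^sub>\<kappa>\<^sub>,\<^sub>l z = sup\<^sub>x (l x - \<kappa> d(z,x)\<^sup>2)\<close>; for an \<open>L\<close>-Lipschitz loss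
  the optimal multiplier is at most \<open>L / \<alpha>\<close>. Using the empirical multiplier of the minimizer
  and the population multiplier of the optimal loss, the excess risk is at most the supremum of
  \<open>X\<^sub>\<kappa>\<^sub>,\<^sub>l = E \<phi>\<^sub>\<kappa>\<^sub>,\<^sub>l - E\<^sub>N \<phi>\<^sub>\<kappa>\<^sub>,\<^sub>l\<close> over \<open>\<kappa> \<in> [0, L / \<alpha>]\<close> and \<open>l \<in> F\<close>, minus the value of this process
  at one fixed index. Since \<open>\<phi>\<close> is 1-Lipschitz in \<open>l\<close> and \<open>diam\<^sup>2\<close>-Lipschitz in \<open>\<kappa>\<close>, chaining bounds
  the expected supremum, and McDiarmid's inequality controls both fluctuations. The slack in
  the term with factor 3 pays for replacing the supremum by a maximum over a finite net, which
  removes all measurability questions.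
\<close>

section \<open>Wasserstein duality\<close>

text \<open>\<open>WRisk\<close> is not linear in its base measure, so the gap between the risk
  under \<open>P\<close> and under the sample is not a deviation of sample means. For a fixed
  multiplier the dual objective is linear, and the term \<open>\<kappa> * \<alpha>\<^sup>2\<close>
  cancels if one multiplier serves both measures, through strong duality for one and weak duality
  for the other. The price is that the multiplier of the minimizer depends on the sample, so
  multipliers need a bounded range and must be chained together with the losses.

  No optimal coupling is ever produced. The value function \<open>budget_risk\<close> constrains the
  cost of a plan directly; mixing plans makes it concave, which yields a multiplier, and measurable
  near-maximizers of \<open>c_transform\<close> yield plans. Raising the squared budget from 0 to
  \<open>\<alpha>\<^sup>2\<close> increases the value by at most L * \<alpha>, whence the range up
  to L / \<alpha>.

  Multipliers are measured in units of the squared diameter, so that both coordinates of an index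
  share the same dyadic scales. The multipliers then contribute a multiple of the scaled length of
  their interval. Chaining gives the constants 12 and 24, both below 48.\<close>

definition c_transform :: "real \<Rightarrow> ('z::metric_space \<Rightarrow> real) \<Rightarrow> 'z \<Rightarrow> real" where
  "c_transform \<kappa> l z = (SUP x. l x - \<kappa> * (dist z x)\<^sup>2)"

lemma c_transform_upper:
  assumes "\<kappa> \<ge> 0" and "\<And>x. l x \<le> B"
  shows "l x - \<kappa> * (dist z x)\<^sup>2 \<le> c_transform \<kappa> l z"
  unfolding c_transform_def
proof (rule cSUP_upper)
  have "l x - \<kappa> * (dist z x)\<^sup>2 \<le> B" for x
    using assms(1) assms(2)[of x] by (smt (verit) mult_nonneg_nonneg zero_le_power2)
  then show "bdd_above (range (\<lambda>x. l x - \<kappa> * (dist z x)\<^sup>2))"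
    by (intro bdd_aboveI2)
qed simp

lemma c_transform_least:
  assumes "\<And>x. l x - \<kappa> * (dist z x)\<^sup>2 \<le> u"
  shows "c_transform \<kappa> l z \<le> u"
  unfolding c_transform_def using assms by (intro cSUP_least) auto

lemma c_transform_ge:
  assumes "\<kappa> \<ge> 0" and "\<And>x. l x \<le> B"
  shows "l z \<le> c_transform \<kappa> l z"
  using c_transform_upper[of \<kappa> l B z z, OF assms] by simp

lemma c_transform_le:
  assumes "\<kappa> \<ge> 0" and "\<And>x. l x \<le> B"
  shows "c_transform \<kappa> l z \<le> B"
  using assms by (intro c_transform_least) (smt (verit) mult_nonneg_nonneg zero_le_power2)

lemma c_transform_near_sup:
  assumes "u < c_transform \<kappa> l z"
  obtains x where "u < l x - \<kappa> * (dist z x)\<^sup>2"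
  using assms c_transform_least[of l \<kappa> z u] by (meson not_less)

text \<open>Chaining moves loss and multiplier at once, so one estimate treats both. Weighting the
  change of multiplier by \<open>D\<^sup>2\<close> makes it comparable with the uniform distance of
  the losses.\<close>

lemma c_transform_perturb:
  fixes l m :: "'z::metric_space \<Rightarrow> real"
  assumes nn: "\<kappa> \<ge> 0" "\<mu> \<ge> 0" and bd: "\<And>x. l x \<le> B" "\<And>x. m x \<le> B"
    and lm: "\<And>x. \<bar>l x - m x\<bar> \<le> a" and D: "\<And>x y :: 'z. dist x y \<le> D"
    and b: "D\<^sup>2 * \<bar>\<kappa> - \<mu>\<bar> \<le> b"
  shows "\<bar>c_transform \<kappa> l z - c_transform \<mu> m z\<bar> \<le> a + b"
proof -
  have *: "c_transform \<kappa> l z \<le> c_transform \<mu> m z + (a + b)"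
    if nn: "\<kappa> \<ge> 0" "\<mu> \<ge> 0" and bd: "\<And>x. l x \<le> B" "\<And>x. m x \<le> B"
      and lm: "\<And>x. \<bar>l x - m x\<bar> \<le> a" and b: "D\<^sup>2 * \<bar>\<kappa> - \<mu>\<bar> \<le> b" for l m \<kappa> \<mu>
  proof (rule c_transform_least)
    fix x
    have "(\<mu> - \<kappa>) * (dist z x)\<^sup>2 \<le> \<bar>\<kappa> - \<mu>\<bar> * D\<^sup>2"
      using D by (intro mult_mono power_mono) auto
    also have "\<dots> \<le> b"
      using b by (simp add: mult.commute)
    finally have "l x - \<kappa> * (dist z x)\<^sup>2 \<le> m x - \<mu> * (dist z x)\<^sup>2 + (a + b)"
      using lm[of x] by (simp add: algebra_simps abs_le_iff)
    then show "l x - \<kappa> * (dist z x)\<^sup>2 \<le> c_transform \<mu> m z + (a + b)"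
      using c_transform_upper[of \<mu> m B x z, OF nn(2) bd(2)] by simp
  qed
  have "c_transform \<kappa> l z \<le> c_transform \<mu> m z + (a + b)"
    by (intro *[OF nn bd lm b])
  moreover have "c_transform \<mu> m z \<le> c_transform \<kappa> l z + (a + b)"
    using lm b by (intro *[OF nn(2,1) bd(2,1)]) (auto simp: abs_minus_commute)
  ultimately show ?thesis by (simp add: abs_le_iff)
qed

text \<open>A supremum of continuous functions is lower semicontinuous.\<close>
lemma borel_measurable_c_transform:
  assumes "\<kappa> \<ge> 0" and "\<And>x. l x \<le> B"
  shows "c_transform \<kappa> l \<in> borel_measurable borel"
proof -
  have "{z. u < c_transform \<kappa> l z} = (\<Union>x. {z. u < l x - \<kappa> * (dist z x)\<^sup>2})" for u
  proof (intro set_eqI iffI)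
    fix z assume "z \<in> {z. u < c_transform \<kappa> l z}"
    then obtain x where "u < l x - \<kappa> * (dist z x)\<^sup>2"
      using c_transform_near_sup by blast
    then show "z \<in> (\<Union>x. {z. u < l x - \<kappa> * (dist z x)\<^sup>2})" by blast
  next
    fix z assume "z \<in> (\<Union>x. {z. u < l x - \<kappa> * (dist z x)\<^sup>2})"
    then obtain x where "u < l x - \<kappa> * (dist z x)\<^sup>2" by blast
    also have "\<dots> \<le> c_transform \<kappa> l z"
      by (rule c_transform_upper[OF assms])
    finally show "z \<in> {z. u < c_transform \<kappa> l z}" by simp
  qed
  moreover have "open {z. u < l x - \<kappa> * (dist z x)\<^sup>2}" for u x
    by (intro open_Collect_less continuous_intros)
  ultimately have "{z. u < c_transform \<kappa> l z} \<in> sets borel" for u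
    by (simp add: borel_open open_UN)
  then show ?thesis
    by (simp add: borel_measurable_iff_greater)
qed

text \<open>Enumerate a countable dense set and take the first point that is good enough.\<close>
lemma c_transform_selection:
  fixes l :: "'z::{metric_space, second_countable_topology} \<Rightarrow> real"
  assumes l: "continuous_on UNIV l" and e: "e > 0"
    and meas: "c_transform \<kappa> l \<in> borel_measurable borel"
  obtains T where "T \<in> measurable borel borel"
    "\<And>z. c_transform \<kappa> l z - e < l (T z) - \<kappa> * (dist z (T z))\<^sup>2"
proof -
  obtain D :: "'z set" where D: "countable D" "\<And>X. open X \<Longrightarrow> X \<noteq> {} \<Longrightarrow> \<exists>d\<in>D. d \<in> X"
    by (rule countable_dense_setE) blast
  have "D \<noteq> {}" using D(2)[of UNIV] by auto
  define d where "d = from_nat_into D"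
  have [measurable]: "l \<in> borel_measurable borel"
    using l by (rule borel_measurable_continuous_onI)
  define good where "good = (\<lambda>z k. c_transform \<kappa> l z - e < l (d k) - \<kappa> * (dist z (d k))\<^sup>2)"
  have ex: "\<exists>k. good z k" for z
  proof -
    \<comment> \<open>Continuity of \<open>l\<close> makes this set open, so it meets the dense set
      as soon as it is nonempty.\<close>
    let ?X = "{x. c_transform \<kappa> l z - e < l x - \<kappa> * (dist z x)\<^sup>2}"
    have "open ?X"
      using l by (intro open_Collect_less continuous_intros)
    moreover have "?X \<noteq> {}"
      using c_transform_near_sup[of "c_transform \<kappa> l z - e" \<kappa> l z] e by auto
    ultimately obtain x where "x \<in> D" "x \<in> ?X"
      using D(2) by blast
    then show ?thesis
      using from_nat_into_surj[OF D(1)] unfolding good_def d_def by auto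
  qed
  show ?thesis
  proof
    have [measurable]: "c_transform \<kappa> l \<in> borel_measurable borel"
      by (rule meas)
    have "Measurable.pred borel (\<lambda>z. good z k)" for k
      unfolding good_def by measurable
    then have *: "(\<lambda>z. LEAST k. good z k) \<in> measurable borel (count_space UNIV)"
      by measurable
    show "(\<lambda>z. d (LEAST k. good z k)) \<in> measurable borel borel"
      by (rule measurable_compose[OF *]) simp
    show "c_transform \<kappa> l z - e < l (d (LEAST k. good z k)) - \<kappa> * (dist z (d (LEAST k. good z k)))\<^sup>2" for z
      using LeastI_ex[OF ex[of z]] by (simp add: good_def)
  qed
qed

text \<open>Drawing a Bernoulli variable to choose between the two measures is a monadic bind, so
  the probability property and the integrals follow from the Giry monad rather than from an explicit
  set function.\<close>

lemma mixture_measure: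
  assumes \<gamma>: "sets \<gamma>\<^sub>1 = sets K" "sets \<gamma>\<^sub>2 = sets K" "prob_space \<gamma>\<^sub>1" "prob_space \<gamma>\<^sub>2"
    and u: "0 \<le> u" "u \<le> 1"
  obtains \<gamma> where "sets \<gamma> = sets K" "prob_space \<gamma>"
    "\<And>h. h \<in> borel_measurable K \<Longrightarrow>
       nn_integral \<gamma> h = ennreal u * nn_integral \<gamma>\<^sub>1 h + ennreal (1 - u) * nn_integral \<gamma>\<^sub>2 h"
proof
  let ?k = "\<lambda>b. if b then \<gamma>\<^sub>1 else \<gamma>\<^sub>2"
  let ?p = "measure_pmf (bernoulli_pmf u)"
  have sp: "\<gamma>\<^sub>1 \<in> space (subprob_algebra K)" "\<gamma>\<^sub>2 \<in> space (subprob_algebra K)"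
    using \<gamma> by (simp_all add: space_subprob_algebra prob_space_imp_subprob_space)
  have k: "?k \<in> measurable ?p (subprob_algebra K)"
    unfolding measurable_pmf_measure1 using sp by simp
  show "sets (?p \<bind> ?k) = sets K"
    by (rule sets_bind) (simp_all add: \<gamma>)
  show "prob_space (?p \<bind> ?k)"
    by (rule prob_space.prob_space_bind[OF prob_space_measure_pmf _ k]) (simp add: \<gamma>)
  fix h :: "'a \<Rightarrow> ennreal" assume h: "h \<in> borel_measurable K"
  have "nn_integral (?p \<bind> ?k) h = (\<integral>\<^sup>+b. nn_integral (?k b) h \<partial>?p)"
    by (rule nn_integral_bind[OF h k])
  also have "\<dots> = ennreal u * nn_integral \<gamma>\<^sub>1 h + ennreal (1 - u) * nn_integral \<gamma>\<^sub>2 h"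
    by (subst nn_integral_bernoulli_pmf[OF u]) (simp_all add: mult.commute)
  finally show "nn_integral (?p \<bind> ?k) h = ennreal u * nn_integral \<gamma>\<^sub>1 h + ennreal (1 - u) * nn_integral \<gamma>\<^sub>2 h" .
qed

section \<open>Transport plans and couplings\<close>

text \<open>Couplings with the second marginal left free. The adversary's choice of a measure and of
  a coupling to it becomes one choice, in which both cost and expected loss are linear.\<close>

definition plans :: "'z::metric_space measure \<Rightarrow> ('z \<times> 'z) measure set" where
  "plans P = {\<gamma>. sets \<gamma> = sets (borel \<Otimes>\<^sub>M borel) \<and> prob_space \<gamma> \<and> distr \<gamma> borel fst = P}"

definition cost :: "('z::metric_space \<times> 'z) measure \<Rightarrow> real" where
  "cost \<gamma> = (\<integral>p. (dist (fst p) (snd p))\<^sup>2 \<partial>\<gamma>)"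

lemma couplings_eq_plans: "couplings P Q = {\<gamma> \<in> plans P. distr \<gamma> borel snd = Q}"
  by (auto simp: couplings_def plans_def)

lemma W2_eq_cost: "W2 P Q = sqrt (Inf (cost ` couplings P Q))"
  by (simp add: W2_def cost_def[abs_def])

lemma cost_nonneg: "cost \<gamma> \<ge> 0"
  by (simp add: cost_def)

lemma bdd_below_cost: "bdd_below (cost ` A)"
  by (rule bdd_belowI2[of _ 0]) (rule cost_nonneg)

text \<open>The product measure is a coupling. Without this the infimum in \<open>W2\<close> could
  range over the empty set, where it is unspecified and bounds nothing.\<close>

lemma couplings_nonempty:
  fixes P Q :: "'z::metric_space measure"
  assumes "prob_space P" "prob_space Q" "sets P = sets borel" "sets Q = sets borel"
  shows "couplings P Q \<noteq> {}"
proof -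
  interpret P: prob_space P by fact
  interpret Q: prob_space Q by fact
  interpret PQ: pair_prob_space P Q ..
  have "distr (P \<Otimes>\<^sub>M Q) borel fst = distr (P \<Otimes>\<^sub>M Q) P fst"
    using assms by (intro distr_cong) auto
  then have "distr (P \<Otimes>\<^sub>M Q) borel fst = P"
    by (simp add: Q.distr_pair_fst)
  moreover have "distr (P \<Otimes>\<^sub>M Q) borel snd = Q"
  proof (rule measure_eqI)
    fix A assume "A \<in> sets (distr (P \<Otimes>\<^sub>M Q) borel snd)"
    then have A: "A \<in> sets Q" "A \<in> sets borel" using assms by auto
    have snd: "snd \<in> measurable (P \<Otimes>\<^sub>M Q) borel"
      using measurable_snd measurable_cong_sets[OF refl assms(4)] by blast
    have "snd -` A \<inter> space (P \<Otimes>\<^sub>M Q) = space P \<times> A"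
      using sets.sets_into_space[OF A(1)] by (auto simp: space_pair_measure)
    then have "emeasure (distr (P \<Otimes>\<^sub>M Q) borel snd) A = emeasure P (space P) * emeasure Q A"
      using A snd by (simp add: emeasure_distr Q.emeasure_pair_measure_Times)
    then show "emeasure (distr (P \<Otimes>\<^sub>M Q) borel snd) A = emeasure Q A"
      by (simp add: P.emeasure_space_1)
  qed (use assms in simp)
  ultimately have "P \<Otimes>\<^sub>M Q \<in> couplings P Q"
    using assms PQ.prob_space_axioms by (auto simp: couplings_def intro: sets_pair_measure_cong)
  then show ?thesis by blast
qed

section \<open>Primal and dual risk of a single Lipschitz loss\<close>

locale lipschitz_loss =
  fixes l :: "'z::polish_space \<Rightarrow> real" and B L :: real
  assumes bounded_space: "bounded (UNIV :: 'z set)"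
    and nonneg: "0 \<le> l z" and le_B: "l z \<le> B"
    and lipschitz: "l z' - l z \<le> L * dist z z'" and L_nonneg: "0 \<le> L"
begin

lemma continuous: "continuous_on UNIV l"
proof (rule lipschitz_on_continuous_on)
  show "(max L 0)-lipschitz_on UNIV l"
  proof (rule lipschitz_onI)
    fix x y :: 'z
    have "L * dist x y \<le> max L 0 * dist x y"
      by (intro mult_right_mono) auto
    then show "dist (l x) (l y) \<le> max L 0 * dist x y"
      using lipschitz[of x y] lipschitz[of y x] by (simp add: dist_real_def dist_commute)
  qed simp
qed

lemma measurable_loss [measurable]: "l \<in> borel_measurable borel"
  using continuous by (rule borel_measurable_continuous_onI)

lemma dist_le: "dist (x :: 'z) y \<le> diameter (UNIV :: 'z set)"
  using diameter_bounded_bound[OF bounded_space] by blast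

lemma integrable_bounded:
  fixes h :: "'a \<Rightarrow> real"
  assumes "prob_space \<gamma>" "h \<in> borel_measurable \<gamma>" "\<And>p. \<bar>h p\<bar> \<le> K"
  shows "integrable \<gamma> h"
proof -
  interpret prob_space \<gamma> by fact
  show ?thesis
    using assms(2,3) by (intro integrable_const_bound[where B=K]) auto
qed

context
  fixes P :: "'z measure" and \<gamma>
  assumes \<gamma>: "\<gamma> \<in> plans P"
begin

lemma plan_prob: "prob_space \<gamma>" and plan_sets [measurable_cong]: "sets \<gamma> = sets (borel \<Otimes>\<^sub>M borel)"
  and plan_fst: "distr \<gamma> borel fst = P"
  using \<gamma> by (auto simp: plans_def)

lemma plan_space [simp]: "space \<gamma> = UNIV"
  using sets_eq_imp_space_eq[OF plan_sets] by (simp add: space_pair_measure)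

lemma plan_integral_fst:
  fixes h :: "'z \<Rightarrow> real"
  assumes "h \<in> borel_measurable borel"
  shows "(\<integral>p. h (fst p) \<partial>\<gamma>) = (\<integral>z. h z \<partial>P)"
  unfolding plan_fst[symmetric] using assms by (subst integral_distr) auto

lemma plan_integral_snd:
  fixes h :: "'z \<Rightarrow> real"
  assumes "h \<in> borel_measurable borel"
  shows "(\<integral>z. h z \<partial>distr \<gamma> borel snd) = (\<integral>p. h (snd p) \<partial>\<gamma>)"
  using assms by (subst integral_distr) auto

lemma plan_integrable_cost: "integrable \<gamma> (\<lambda>p. (dist (fst p) (snd p))\<^sup>2)"
  by (rule integrable_bounded[OF plan_prob, where K="(diameter (UNIV :: 'z set))\<^sup>2"])
     (auto intro: power_mono dist_le)

lemma plan_integrable_loss: "integrable \<gamma> (\<lambda>p. l (snd p))" "integrable \<gamma> (\<lambda>p. l (fst p))"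
  by (rule integrable_bounded[OF plan_prob, where K=B], measurable, simp add: nonneg le_B)+

lemma plan_loss_le: "(\<integral>p. l (snd p) \<partial>\<gamma>) \<le> B"
proof -
  interpret prob_space \<gamma> by (rule plan_prob)
  show "(\<integral>p. l (snd p) \<partial>\<gamma>) \<le> B"
    by (intro integral_le_const plan_integrable_loss AE_I2 le_B)
qed

text \<open>Split the distance by AM-GM, \<open>d \<le> (d\<^sup>2 / \<alpha> + \<alpha>) / 2\<close>, instead of using Cauchy-Schwarz.\<close>
lemma plan_loss_lipschitz:
  assumes \<alpha>: "\<alpha> > 0" and c: "cost \<gamma> \<le> \<alpha>\<^sup>2"
  shows "(\<integral>p. l (snd p) \<partial>\<gamma>) \<le> (\<integral>z. l z \<partial>P) + L * \<alpha>"
proof -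
  interpret prob_space \<gamma> by (rule plan_prob)
  have "(\<integral>p. l (snd p) \<partial>\<gamma>) \<le> (\<integral>p. l (fst p) + L / 2 * ((dist (fst p) (snd p))\<^sup>2 / \<alpha> + \<alpha>) \<partial>\<gamma>)"
  proof (rule integral_mono)
    fix p :: "'z \<times> 'z"
    let ?d = "dist (fst p) (snd p)"
    have "2 * ?d * \<alpha> \<le> ?d\<^sup>2 + \<alpha>\<^sup>2"
      by (rule sum_squares_bound)
    then have "?d \<le> (?d\<^sup>2 / \<alpha> + \<alpha>) / 2"
      using \<alpha> by (simp add: field_simps power2_eq_square)
    then have "L * ?d \<le> L * ((?d\<^sup>2 / \<alpha> + \<alpha>) / 2)"
      using L_nonneg by (rule mult_left_mono)
    also have "\<dots> = L / 2 * (?d\<^sup>2 / \<alpha> + \<alpha>)" by simp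
    finally show "l (snd p) \<le> l (fst p) + L / 2 * (?d\<^sup>2 / \<alpha> + \<alpha>)"
      using lipschitz[of "snd p" "fst p"] by linarith
  qed (use plan_integrable_loss plan_integrable_cost in auto)
  also have "\<dots> = (\<integral>z. l z \<partial>P) + L / 2 * (cost \<gamma> / \<alpha> + \<alpha>)"
    using plan_integrable_loss plan_integrable_cost prob_space
    by (simp add: cost_def plan_integral_fst)
  also have "L / 2 * (cost \<gamma> / \<alpha> + \<alpha>) \<le> L / 2 * (\<alpha> + \<alpha>)"
    using c \<alpha> L_nonneg by (intro mult_left_mono add_right_mono) (auto simp: field_simps power2_eq_square)
  finally show ?thesis by simp
qed

end

text \<open>The deterministic plan that moves z to \<open>T z\<close>. A selection of
  near-maximizers becomes a plan in this way, and the identity map gives a plan of cost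
  zero.\<close>

lemma graph_plan:
  assumes P: "prob_space P" "sets P = sets borel" and T [measurable]: "T \<in> measurable borel borel"
  shows "distr P (borel \<Otimes>\<^sub>M borel) (\<lambda>z. (z, T z)) \<in> plans P" (is "?\<gamma> \<in> _")
    and "cost (distr P (borel \<Otimes>\<^sub>M borel) (\<lambda>z. (z, T z))) = (\<integral>z. (dist z (T z))\<^sup>2 \<partial>P)"
    and "(\<integral>p. l (snd p) \<partial>distr P (borel \<Otimes>\<^sub>M borel) (\<lambda>z. (z, T z))) = (\<integral>z. l (T z) \<partial>P)"
proof -
  have g: "(\<lambda>z. (z, T z)) \<in> measurable P (borel \<Otimes>\<^sub>M borel)"
    unfolding measurable_cong_sets[OF P(2) refl] by measurable
  have f: "fst \<in> measurable (borel \<Otimes>\<^sub>M borel) (borel :: 'z measure)"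
    by (rule measurable_fst)
  have "distr ?\<gamma> borel fst = distr P borel (\<lambda>z. z)"
    using distr_distr[OF f g] by (simp add: comp_def)
  also have "\<dots> = P"
    using P(2) by (simp add: distr_id2)
  finally show "?\<gamma> \<in> plans P"
    using prob_space.prob_space_distr[OF P(1) g] by (simp add: plans_def)
  have d: "(\<lambda>p. (dist (fst p) (snd p))\<^sup>2) \<in> borel_measurable (borel \<Otimes>\<^sub>M (borel :: 'z measure))"
    by measurable
  show "cost ?\<gamma> = (\<integral>z. (dist z (T z))\<^sup>2 \<partial>P)"
    unfolding cost_def integral_distr[OF g d] by simp
  have l: "(\<lambda>p. l (snd p)) \<in> borel_measurable (borel \<Otimes>\<^sub>M (borel :: 'z measure))"
    by measurable
  show "(\<integral>p. l (snd p) \<partial>?\<gamma>) = (\<integral>z. l (T z) \<partial>P)"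
    unfolding integral_distr[OF g l] by simp
qed

text \<open>The primal value function. Its variable is the squared radius, because the cost of a
  plan, unlike its root, is linear under mixing. The constraint is on the plan itself and not on
  \<open>W2\<close>, so attainment of an infimum over couplings never matters.\<close>

definition budget_risk :: "'z measure \<Rightarrow> real \<Rightarrow> real" where
  "budget_risk P e = Sup ((\<lambda>\<gamma>. \<integral>p. l (snd p) \<partial>\<gamma>) ` {\<gamma> \<in> plans P. cost \<gamma> \<le> e})"

lemma budget_risk_upper:
  assumes "\<gamma> \<in> plans P" "cost \<gamma> \<le> e"
  shows "(\<integral>p. l (snd p) \<partial>\<gamma>) \<le> budget_risk P e"
  unfolding budget_risk_def
proof (rule cSUP_upper)
  show "bdd_above ((\<lambda>\<gamma>. \<integral>p. l (snd p) \<partial>\<gamma>) ` {\<gamma> \<in> plans P. cost \<gamma> \<le> e})"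
    using plan_loss_le by (intro bdd_aboveI2[where M=B]) blast
qed (use assms in simp)

lemma integral_loss_le:
  assumes "Q \<in> borel_probs"
  shows "(\<integral>z. l z \<partial>Q) \<le> B"
proof -
  interpret prob_space Q using assms by (simp add: borel_probs_def)
  have "l \<in> borel_measurable Q"
    using assms measurable_loss measurable_cong_sets[OF _ refl, of Q borel] unfolding borel_probs_def by blast
  then show ?thesis
    using nonneg le_B by (intro integral_le_const integrable_const_bound[where B=B]) auto
qed

lemma WRisk_upper:
  assumes "Q \<in> borel_probs" "W2 P Q \<le> \<alpha>"
  shows "(\<integral>z. l z \<partial>Q) \<le> WRisk P \<alpha> l"
  unfolding WRisk_def
proof (rule cSUP_upper)
  show "bdd_above ((\<lambda>Q. \<integral>z. l z \<partial>Q) ` {Q \<in> borel_probs. W2 P Q \<le> \<alpha>})"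
    using integral_loss_le by (intro bdd_aboveI2[where M=B]) blast
qed (use assms in simp)

context
  fixes P :: "'z measure"
  assumes P: "prob_space P" "sets P = sets borel"
begin

lemma measurable_base: "h \<in> measurable borel M \<Longrightarrow> h \<in> measurable P M"
  using measurable_cong_sets[OF P(2) refl] by blast

lemma diagonal_plan:
  obtains \<gamma> where "\<gamma> \<in> plans P" "cost \<gamma> = 0" "(\<integral>p. l (snd p) \<partial>\<gamma>) = (\<integral>z. l z \<partial>P)"
    "distr \<gamma> borel snd = P"
proof
  let ?\<gamma> = "distr P (borel \<Otimes>\<^sub>M borel) (\<lambda>z. (z, z))"
  note g = graph_plan[OF P, of "\<lambda>z. z", simplified]
  show "?\<gamma> \<in> plans P" "cost ?\<gamma> = 0" "(\<integral>p. l (snd p) \<partial>?\<gamma>) = (\<integral>z. l z \<partial>P)"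
    using g by simp_all
  have "(\<lambda>z. (z, z)) \<in> measurable P (borel \<Otimes>\<^sub>M borel)"
    by (rule measurable_base) measurable
  then have "distr ?\<gamma> borel snd = distr P borel (\<lambda>z. z)"
    using distr_distr[OF measurable_snd, of "\<lambda>z. (z, z)" P borel borel] by (simp add: comp_def)
  also have "\<dots> = P"
    using P(2) by (simp add: distr_id2)
  finally show "distr ?\<gamma> borel snd = P" .
qed

lemma budget_risk_least:
  assumes "e \<ge> 0" "\<And>\<gamma>. \<gamma> \<in> plans P \<Longrightarrow> cost \<gamma> \<le> e \<Longrightarrow> (\<integral>p. l (snd p) \<partial>\<gamma>) \<le> u"
  shows "budget_risk P e \<le> u"
  unfolding budget_risk_def
proof (rule cSUP_least)
  obtain \<gamma> where "\<gamma> \<in> plans P" "cost \<gamma> = 0"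
    by (rule diagonal_plan)
  then show "{\<gamma> \<in> plans P. cost \<gamma> \<le> e} \<noteq> {}"
    using assms(1) by auto
qed (use assms in simp)

lemma budget_risk_mono: "0 \<le> e \<Longrightarrow> e \<le> e' \<Longrightarrow> budget_risk P e \<le> budget_risk P e'"
  by (rule budget_risk_least) (auto intro: budget_risk_upper)

lemma W2_self: "W2 P P = 0"
proof -
  obtain \<gamma> where \<gamma>: "\<gamma> \<in> couplings P P" "cost \<gamma> = 0"
    using diagonal_plan by (metis (mono_tags, lifting) couplings_eq_plans mem_Collect_eq)
  have "Inf (cost ` couplings P P) \<le> 0"
    using cINF_lower[OF bdd_below_cost \<gamma>(1)] \<gamma>(2) by simp
  moreover have "Inf (cost ` couplings P P) \<ge> 0"
    using \<gamma>(1) by (intro cINF_greatest cost_nonneg) auto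
  ultimately show ?thesis by (simp add: W2_eq_cost)
qed

lemma plans_convex:
  assumes \<gamma>: "\<gamma>\<^sub>1 \<in> plans P" "\<gamma>\<^sub>2 \<in> plans P" and u: "0 \<le> u" "u \<le> 1"
  obtains \<gamma> where "\<gamma> \<in> plans P" "cost \<gamma> = u * cost \<gamma>\<^sub>1 + (1 - u) * cost \<gamma>\<^sub>2"
    "(\<integral>p. l (snd p) \<partial>\<gamma>) = u * (\<integral>p. l (snd p) \<partial>\<gamma>\<^sub>1) + (1 - u) * (\<integral>p. l (snd p) \<partial>\<gamma>\<^sub>2)"
proof -
  let ?K = "borel \<Otimes>\<^sub>M borel :: ('z \<times> 'z) measure"
  obtain \<gamma> where sets: "sets \<gamma> = sets ?K" and prob: "prob_space \<gamma>"
    and nn: "\<And>h. h \<in> borel_measurable ?K \<Longrightarrow>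
       nn_integral \<gamma> h = ennreal u * nn_integral \<gamma>\<^sub>1 h + ennreal (1 - u) * nn_integral \<gamma>\<^sub>2 h"
    using mixture_measure[OF plan_sets[OF \<gamma>(1)] plan_sets[OF \<gamma>(2)] plan_prob[OF \<gamma>(1)] plan_prob[OF \<gamma>(2)] u]
    by blast
  have fst: "fst \<in> measurable \<gamma>' borel" if "sets \<gamma>' = sets ?K" for \<gamma>' :: "('z \<times> 'z) measure"
    using measurable_fst measurable_cong_sets[OF that refl] by blast
  have marg: "emeasure \<gamma>' (fst -` A \<inter> space \<gamma>') = emeasure P A"
    if "\<gamma>' \<in> plans P" "A \<in> sets borel" for \<gamma>' :: "('z \<times> 'z) measure" and A
    using emeasure_distr[OF fst[OF plan_sets[OF that(1)]] that(2)] plan_fst[OF that(1)] by simp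
  have sp: "space \<gamma> = UNIV"
    using sets_eq_imp_space_eq[OF sets] by (simp add: space_pair_measure)
  have "distr \<gamma> borel fst = P"
  proof (rule measure_eqI)
    fix A assume "A \<in> sets (distr \<gamma> borel fst)"
    then have A: "A \<in> sets borel" by simp
    have [measurable]: "fst -` A \<in> sets ?K"
      using measurable_sets[OF measurable_fst A, of borel] by (simp add: space_pair_measure)
    have "emeasure (distr \<gamma> borel fst) A = nn_integral \<gamma> (indicator (fst -` A))"
      using A fst[OF sets] sp sets by (simp add: emeasure_distr)
    also have "\<dots> = ennreal u * nn_integral \<gamma>\<^sub>1 (indicator (fst -` A))
        + ennreal (1 - u) * nn_integral \<gamma>\<^sub>2 (indicator (fst -` A))"
      by (rule nn) measurable
    also have "\<dots> = ennreal u * emeasure P A + ennreal (1 - u) * emeasure P A"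
      using marg[OF \<gamma>(1) A] marg[OF \<gamma>(2) A] plan_sets[OF \<gamma>(1)] plan_sets[OF \<gamma>(2)]
      by (simp add: plan_space[OF \<gamma>(1)] plan_space[OF \<gamma>(2)])
    also have "\<dots> = emeasure P A"
      using u by (simp flip: distrib_right ennreal_plus)
    finally show "emeasure (distr \<gamma> borel fst) A = emeasure P A" .
  qed (simp add: P)
  then have \<gamma>P: "\<gamma> \<in> plans P"
    using sets prob by (simp add: plans_def)
  have int: "(\<integral>p. h p \<partial>\<gamma>) = u * (\<integral>p. h p \<partial>\<gamma>\<^sub>1) + (1 - u) * (\<integral>p. h p \<partial>\<gamma>\<^sub>2)"
    if h: "h \<in> borel_measurable ?K" "\<And>p. 0 \<le> h p"
      and i: "integrable \<gamma>\<^sub>1 h" "integrable \<gamma>\<^sub>2 h" "integrable \<gamma> h" for h :: "'z \<times> 'z \<Rightarrow> real"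
  proof -
    have "ennreal (\<integral>p. h p \<partial>\<gamma>) = (\<integral>\<^sup>+p. ennreal (h p) \<partial>\<gamma>)"
      using h i by (intro nn_integral_eq_integral[symmetric]) auto
    also have "\<dots> = ennreal u * (\<integral>\<^sup>+p. ennreal (h p) \<partial>\<gamma>\<^sub>1) + ennreal (1 - u) * (\<integral>\<^sup>+p. ennreal (h p) \<partial>\<gamma>\<^sub>2)"
      using h by (intro nn) measurable
    also have "\<dots> = ennreal u * ennreal (\<integral>p. h p \<partial>\<gamma>\<^sub>1) + ennreal (1 - u) * ennreal (\<integral>p. h p \<partial>\<gamma>\<^sub>2)"
      using h i by (simp add: nn_integral_eq_integral)
    also have "\<dots> = ennreal (u * (\<integral>p. h p \<partial>\<gamma>\<^sub>1) + (1 - u) * (\<integral>p. h p \<partial>\<gamma>\<^sub>2))"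
      using u h(2) by (simp add: ennreal_mult ennreal_plus)
    finally show ?thesis
      using u h(2) by (subst (asm) ennreal_inj) auto
  qed
  show thesis
  proof (rule that[OF \<gamma>P])
    show "cost \<gamma> = u * cost \<gamma>\<^sub>1 + (1 - u) * cost \<gamma>\<^sub>2"
      unfolding cost_def
      by (rule int) (use plan_integrable_cost \<gamma> \<gamma>P in auto)
    show "(\<integral>p. l (snd p) \<partial>\<gamma>) = u * (\<integral>p. l (snd p) \<partial>\<gamma>\<^sub>1) + (1 - u) * (\<integral>p. l (snd p) \<partial>\<gamma>\<^sub>2)"
      by (rule int) (use plan_integrable_loss \<gamma> \<gamma>P nonneg in auto)
  qed
qed

text \<open>Mixing plans of budgets \<open>x\<close> and \<open>y\<close> gives a plan within the
  mixed budget that has the mixed expected loss.\<close>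

lemma budget_risk_concave: "convex_on {0..} (\<lambda>e. - budget_risk P e)"
proof (rule convex_onI)
  fix t x y :: real
  assume t: "0 < t" "t < 1" and xy: "x \<in> {0..}" "y \<in> {0..}"
  let ?z = "(1 - t) * x + t * y"
  have le: "(1 - t) * (\<integral>p. l (snd p) \<partial>\<gamma>\<^sub>1) + t * (\<integral>p. l (snd p) \<partial>\<gamma>\<^sub>2) \<le> budget_risk P ?z"
    if \<gamma>: "\<gamma>\<^sub>1 \<in> plans P" "cost \<gamma>\<^sub>1 \<le> x" "\<gamma>\<^sub>2 \<in> plans P" "cost \<gamma>\<^sub>2 \<le> y" for \<gamma>\<^sub>1 \<gamma>\<^sub>2
  proof -
    obtain \<gamma> where g: "\<gamma> \<in> plans P" "cost \<gamma> = (1 - t) * cost \<gamma>\<^sub>1 + (1 - (1 - t)) * cost \<gamma>\<^sub>2"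
      "(\<integral>p. l (snd p) \<partial>\<gamma>) = (1 - t) * (\<integral>p. l (snd p) \<partial>\<gamma>\<^sub>1) + (1 - (1 - t)) * (\<integral>p. l (snd p) \<partial>\<gamma>\<^sub>2)"
      using plans_convex[OF \<gamma>(1,3), of "1 - t"] t by auto
    have "cost \<gamma> \<le> ?z"
      using g(2) t \<gamma> by (auto intro!: add_mono mult_left_mono)
    then show ?thesis
      using budget_risk_upper[OF g(1)] g(3) by simp
  qed
  \<comment> \<open>Maximizing plans need not exist, so the two suprema are taken one after the
    other: over the second plan with the first one fixed, then over the first.\<close>
  have "budget_risk P x \<le> (budget_risk P ?z - t * budget_risk P y) / (1 - t)"
  proof (rule budget_risk_least)
    fix \<gamma>\<^sub>1 assume 1: "\<gamma>\<^sub>1 \<in> plans P" "cost \<gamma>\<^sub>1 \<le> x"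
    have "budget_risk P y \<le> (budget_risk P ?z - (1 - t) * (\<integral>p. l (snd p) \<partial>\<gamma>\<^sub>1)) / t"
    proof (rule budget_risk_least)
      fix \<gamma>\<^sub>2 assume "\<gamma>\<^sub>2 \<in> plans P" "cost \<gamma>\<^sub>2 \<le> y"
      then show "(\<integral>p. l (snd p) \<partial>\<gamma>\<^sub>2) \<le> (budget_risk P ?z - (1 - t) * (\<integral>p. l (snd p) \<partial>\<gamma>\<^sub>1)) / t"
        using le[OF 1] t by (simp add: pos_le_divide_eq mult.commute algebra_simps)
    qed (use xy in simp)
    then show "(\<integral>p. l (snd p) \<partial>\<gamma>\<^sub>1) \<le> (budget_risk P ?z - t * budget_risk P y) / (1 - t)"
      using t by (simp add: pos_le_divide_eq algebra_simps)
  qed (use xy in simp)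
  then show "- budget_risk P ((1 - t) *\<^sub>R x + t *\<^sub>R y) \<le> (1 - t) * (- budget_risk P x) + t * (- budget_risk P y)"
    using t by (simp add: pos_le_divide_eq algebra_simps)
qed simp

text \<open>Integrate \<open>l y \<le> c_transform \<kappa> l x + \<kappa> * (dist x
  y)\<^sup>2\<close> against an arbitrary coupling. The infimum over couplings is taken only
  afterwards, because \<open>W2 P Q \<le> \<alpha>\<close> says nothing about any particular
  one.\<close>

lemma weak_duality:
  assumes \<kappa>: "\<kappa> \<ge> 0" and \<alpha>: "\<alpha> > 0"
  shows "WRisk P \<alpha> l \<le> \<kappa> * \<alpha>\<^sup>2 + (\<integral>z. c_transform \<kappa> l z \<partial>P)"
  unfolding WRisk_def
proof (rule cSUP_least)
  show "{Q \<in> borel_probs. W2 P Q \<le> \<alpha>} \<noteq> {}"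
    using P W2_self \<alpha> by (auto simp: borel_probs_def intro!: exI[of _ P])
next
  fix Q assume "Q \<in> {Q \<in> borel_probs. W2 P Q \<le> \<alpha>}"
  then have Q: "prob_space Q" "sets Q = sets borel" and W: "W2 P Q \<le> \<alpha>"
    by (auto simp: borel_probs_def)
  let ?c = "\<integral>z. c_transform \<kappa> l z \<partial>P"
  have meas: "c_transform \<kappa> l \<in> borel_measurable borel"
    by (rule borel_measurable_c_transform[OF \<kappa> le_B])
  have ne: "couplings P Q \<noteq> {}"
    by (rule couplings_nonempty[OF P(1) Q(1) P(2) Q(2)])
  have key: "(\<integral>z. l z \<partial>Q) - ?c \<le> \<kappa> * cost \<gamma>" if \<gamma>: "\<gamma> \<in> couplings P Q" for \<gamma>
  proof -
    have \<gamma>P: "\<gamma> \<in> plans P" and \<gamma>Q: "distr \<gamma> borel snd = Q"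
      using \<gamma> by (auto simp: couplings_eq_plans)
    interpret prob_space \<gamma> by (rule plan_prob[OF \<gamma>P])
    note [measurable_cong] = plan_sets[OF \<gamma>P]
    have ic: "integrable \<gamma> (\<lambda>p. c_transform \<kappa> l (fst p))"
    proof (rule integrable_bounded[where K=B])
      show "\<bar>c_transform \<kappa> l (fst p)\<bar> \<le> B" for p :: "'z \<times> 'z"
        using c_transform_le[of \<kappa> l B "fst p", OF \<kappa> le_B] c_transform_ge[of \<kappa> l B "fst p", OF \<kappa> le_B]
          nonneg[of "fst p"] by (simp add: abs_le_iff)
    next
      show "(\<lambda>p. c_transform \<kappa> l (fst p)) \<in> borel_measurable \<gamma>"
        using measurable_compose[OF measurable_fst meas] measurable_cong_sets[OF plan_sets[OF \<gamma>P] refl]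
        by blast
    qed (rule prob_space_axioms)
    have "(\<integral>z. l z \<partial>Q) = (\<integral>p. l (snd p) \<partial>\<gamma>)"
      using plan_integral_snd[OF \<gamma>P measurable_loss] \<gamma>Q by simp
    also have "\<dots> \<le> (\<integral>p. c_transform \<kappa> l (fst p) + \<kappa> * (dist (fst p) (snd p))\<^sup>2 \<partial>\<gamma>)"
    proof (rule integral_mono)
      fix p :: "'z \<times> 'z"
      show "l (snd p) \<le> c_transform \<kappa> l (fst p) + \<kappa> * (dist (fst p) (snd p))\<^sup>2"
        using c_transform_upper[of \<kappa> l B "snd p" "fst p", OF \<kappa> le_B] by simp
    qed (use plan_integrable_loss[OF \<gamma>P] plan_integrable_cost[OF \<gamma>P] ic in auto)
    also have "\<dots> = ?c + \<kappa> * cost \<gamma>"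
      using ic plan_integrable_cost[OF \<gamma>P] plan_integral_fst[OF \<gamma>P meas] by (simp add: cost_def)
    finally show ?thesis by simp
  qed
  have I: "Inf (cost ` couplings P Q) \<le> \<alpha>\<^sup>2"
  proof -
    have "sqrt (Inf (cost ` couplings P Q)) \<le> \<alpha>"
      using W by (simp add: W2_eq_cost)
    then show ?thesis
      using sqrt_le_D by blast
  qed
  have "(\<integral>z. l z \<partial>Q) - ?c \<le> \<kappa> * Inf (cost ` couplings P Q)"
  \<comment> \<open>Passing to the infimum divides by \<kappa>. For a zero multiplier a single
    coupling already gives the claim.\<close>
  proof (cases "\<kappa> = 0")
    case True
    then show ?thesis using key ne by auto
  next
    case False
    have "((\<integral>z. l z \<partial>Q) - ?c) / \<kappa> \<le> Inf (cost ` couplings P Q)"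
      using key False \<kappa> by (intro cINF_greatest ne) (simp add: pos_divide_le_eq mult.commute)
    then show ?thesis
      using False \<kappa> by (simp add: pos_divide_le_eq mult.commute)
  qed
  also have "\<dots> \<le> \<kappa> * \<alpha>\<^sup>2"
    using I \<kappa> by (rule mult_left_mono)
  finally show "(\<integral>z. l z \<partial>Q) \<le> \<kappa> * \<alpha>\<^sup>2 + ?c" by simp
qed

text \<open>The multiplier is a supergradient at \<open>\<alpha>\<^sup>2\<close> of the concave function \<^term>\<open>budget_risk P\<close>.\<close>
lemma strong_duality:
  assumes \<alpha>: "\<alpha> > 0"
  obtains \<kappa> where "0 \<le> \<kappa>" "\<kappa> \<le> L / \<alpha>" "\<kappa> * \<alpha>\<^sup>2 + (\<integral>z. c_transform \<kappa> l z \<partial>P) \<le> WRisk P \<alpha> l"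
proof -
  interpret P: prob_space P by (rule P)
  let ?v = "budget_risk P"
  \<comment> \<open>The right derivative of \<open>?v\<close> at \<open>\<alpha>\<^sup>2\<close>,
    written as the negated infimum of difference quotients of the convex function
    \<open>- ?v\<close>. The supergradient inequality holds because \<alpha> > 0 puts
    \<open>\<alpha>\<^sup>2\<close> in the interior of the half-line.\<close>
  define \<kappa> where "\<kappa> = - Inf ((\<lambda>t. (- ?v (\<alpha>\<^sup>2) - - ?v t) / (\<alpha>\<^sup>2 - t)) ` ({\<alpha>\<^sup>2<..} \<inter> {0..}))"
  have super: "?v e \<le> ?v (\<alpha>\<^sup>2) + \<kappa> * (e - \<alpha>\<^sup>2)" if "e \<ge> 0" for e
  proof -
    have "\<alpha>\<^sup>2 \<in> interior {0..}"
      using \<alpha> by simp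
    from convex_le_Inf_differential[OF budget_risk_concave this, of e] that
    show ?thesis by (simp add: \<kappa>_def)
  qed
  have "?v (\<alpha>\<^sup>2) \<le> ?v (\<alpha>\<^sup>2 + 1)"
    by (rule budget_risk_mono) auto
  then have \<kappa>0: "0 \<le> \<kappa>"
    using super[of "\<alpha>\<^sup>2 + 1"] by simp
  obtain \<gamma>\<^sub>0 where \<gamma>0: "\<gamma>\<^sub>0 \<in> plans P" "cost \<gamma>\<^sub>0 = 0" "(\<integral>p. l (snd p) \<partial>\<gamma>\<^sub>0) = (\<integral>z. l z \<partial>P)"
    by (rule diagonal_plan)
  \<comment> \<open>The supergradient inequality at budget 0 bounds
    \<open>\<kappa> * \<alpha>\<^sup>2\<close> by the total rise of \<open>?v\<close> over
    \<open>[0, \<alpha>\<^sup>2]\<close>, and the Lipschitz bound limits this rise to L *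
    \<alpha>.\<close>
  have "(\<integral>z. l z \<partial>P) \<le> ?v 0"
    using budget_risk_upper[OF \<gamma>0(1), of 0] \<gamma>0 by simp
  also have "\<dots> \<le> ?v (\<alpha>\<^sup>2) - \<kappa> * \<alpha>\<^sup>2"
    using super[of 0] by simp
  also have "?v (\<alpha>\<^sup>2) \<le> (\<integral>z. l z \<partial>P) + L * \<alpha>"
    using \<alpha> by (intro budget_risk_least plan_loss_lipschitz) auto
  finally have "\<kappa> * \<alpha>\<^sup>2 \<le> L * \<alpha>" by simp
  then have \<kappa>L: "\<kappa> \<le> L / \<alpha>"
    using \<alpha> by (simp add: power2_eq_square pos_le_divide_eq)
  have meas: "c_transform \<kappa> l \<in> borel_measurable borel"
    by (rule borel_measurable_c_transform[OF \<kappa>0 le_B])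
  have bound: "(\<integral>z. c_transform \<kappa> l z \<partial>P) \<le> ?v (\<alpha>\<^sup>2) - \<kappa> * \<alpha>\<^sup>2 + e" if e: "e > 0" for e
  proof -
    obtain T where T [measurable]: "T \<in> measurable borel borel"
      and near: "\<And>z. c_transform \<kappa> l z - e < l (T z) - \<kappa> * (dist z (T z))\<^sup>2"
      using c_transform_selection[OF continuous e meas] by blast
    let ?\<gamma> = "distr P (borel \<Otimes>\<^sub>M borel) (\<lambda>z. (z, T z))"
    note g = graph_plan[OF P T]
    have i1: "integrable P (\<lambda>z. l (T z))"
      by (rule integrable_bounded[OF P(1) measurable_base, where K=B]) (measurable, simp add: nonneg le_B)
    have i2: "integrable P (\<lambda>z. (dist z (T z))\<^sup>2)"
      by (rule integrable_bounded[OF P(1) measurable_base, where K="(diameter (UNIV :: 'z set))\<^sup>2"])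
         (measurable, simp add: power_mono dist_le)
    have i3: "integrable P (\<lambda>z. c_transform \<kappa> l z)"
    proof (rule integrable_bounded[OF P(1) measurable_base[OF meas], where K=B])
      show "\<bar>c_transform \<kappa> l z\<bar> \<le> B" for z
        using c_transform_le[of \<kappa> l B z, OF \<kappa>0 le_B] c_transform_ge[of \<kappa> l B z, OF \<kappa>0 le_B]
          nonneg[of z] by (simp add: abs_le_iff)
    qed
    have "(\<integral>z. c_transform \<kappa> l z \<partial>P) \<le> (\<integral>z. l (T z) - \<kappa> * (dist z (T z))\<^sup>2 + e \<partial>P)"
    proof (rule integral_mono)
      show "c_transform \<kappa> l z \<le> l (T z) - \<kappa> * (dist z (T z))\<^sup>2 + e" for z
        using near[of z] by simp
    qed (use i1 i2 i3 in auto)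
    also have "\<dots> = (\<integral>p. l (snd p) \<partial>?\<gamma>) - \<kappa> * cost ?\<gamma> + e"
      using i1 i2 P.prob_space by (simp add: g)
    \<comment> \<open>The cost of this plan is not controlled in any way, which does no harm: the
      supergradient inequality holds at every nonnegative budget.\<close>
    also have "(\<integral>p. l (snd p) \<partial>?\<gamma>) \<le> ?v (cost ?\<gamma>)"
      using g(1) by (intro budget_risk_upper) auto
    also have "?v (cost ?\<gamma>) \<le> ?v (\<alpha>\<^sup>2) + \<kappa> * (cost ?\<gamma> - \<alpha>\<^sup>2)"
      by (intro super cost_nonneg)
    finally show ?thesis by (simp add: algebra_simps)
  qed
  have "(\<integral>z. c_transform \<kappa> l z \<partial>P) \<le> ?v (\<alpha>\<^sup>2) - \<kappa> * \<alpha>\<^sup>2"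
    by (rule field_le_epsilon) (rule bound)
  \<comment> \<open>A plan within the budget bounds the infimum in \<open>W2\<close> from above, so
    its second marginal lies in the ball.\<close>
  moreover have "?v (\<alpha>\<^sup>2) \<le> WRisk P \<alpha> l"
  proof (rule budget_risk_least)
    fix \<gamma> assume \<gamma>: "\<gamma> \<in> plans P" and c: "cost \<gamma> \<le> \<alpha>\<^sup>2"
    let ?Q = "distr \<gamma> borel snd"
    have snd: "snd \<in> measurable \<gamma> borel"
      using measurable_snd measurable_cong_sets[OF plan_sets[OF \<gamma>] refl] by blast
    have Q: "?Q \<in> borel_probs"
      using prob_space.prob_space_distr[OF plan_prob[OF \<gamma>] snd] by (simp add: borel_probs_def)
    have "\<gamma> \<in> couplings P ?Q"
      using \<gamma> by (simp add: couplings_eq_plans)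
    then have "Inf (cost ` couplings P ?Q) \<le> \<alpha>\<^sup>2"
      using cINF_lower[OF bdd_below_cost] c by (meson order_trans)
    then have "W2 P ?Q \<le> \<alpha>"
      unfolding W2_eq_cost using \<alpha> by (simp add: real_le_lsqrt real_sqrt_le_iff real_le_rsqrt sqrt_le_D real_sqrt_le_mono)
    then show "(\<integral>p. l (snd p) \<partial>\<gamma>) \<le> WRisk P \<alpha> l"
      using WRisk_upper[OF Q] plan_integral_snd[OF \<gamma> measurable_loss] by simp
  qed simp
  ultimately show thesis
    using that[OF \<kappa>0 \<kappa>L] by simp
qed

end

end

section \<open>Concentration and chaining\<close>

text \<open>Stated through the oscillation because it is applied with all other coordinates frozen:
  the interval containing the values moves with these, while its length does not. The left endpoint
  is recovered as the infimum of the values.\<close>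

lemma (in prob_space) Hoeffding_mgf:
  fixes f :: "'a \<Rightarrow> real"
  assumes f [measurable]: "f \<in> borel_measurable M"
    and osc: "\<And>x y. x \<in> space M \<Longrightarrow> y \<in> space M \<Longrightarrow> f x - f y \<le> c"
    and s: "s > 0"
  shows "(\<integral>x. exp (s * (f x - expectation f)) \<partial>M) \<le> exp (s\<^sup>2 * c\<^sup>2 / 8)"
proof -
  obtain x0 where x0: "x0 \<in> space M"
    using not_empty by blast
  define a where "a = (INF x\<in>space M. f x)"
  have bdd: "bdd_below (f ` space M)"
    using osc[OF x0] by (intro bdd_belowI2[of _ "f x0 - c"]) (auto simp: algebra_simps)
  have "f x \<in> {a..a + c}" if x: "x \<in> space M" for x
  proof -
    have "f x - c \<le> a"
      unfolding a_def using x0 osc[OF x] by (intro cINF_greatest) (auto simp: algebra_simps)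
    moreover have "a \<le> f x"
      unfolding a_def by (intro cINF_lower bdd x)
    ultimately show ?thesis by auto
  qed
  then interpret interval_bounded_random_variable M f a "a + c"
    by unfold_locales auto
  have "nn_integral M (\<lambda>x. exp (s * (f x - expectation f))) \<le> ennreal (exp (s\<^sup>2 * c\<^sup>2 / 8))"
    using Hoeffdings_lemma_nn_integral[OF s] by simp
  then show ?thesis
    by (subst integral_eq_nn_integral) (auto intro: enn2real_leI)
qed

text \<open>Integrating out the last coordinate preserves bounded differences, so Hoeffding's lemma
  applies one coordinate at a time.\<close>
lemma McDiarmid_mgf:
  fixes f :: "(nat \<Rightarrow> 'a) \<Rightarrow> real"
  assumes P: "prob_space P"
    and f: "f \<in> borel_measurable (PiM {..<N} (\<lambda>_. P))"
    and bound: "\<And>w. w \<in> space (PiM {..<N} (\<lambda>_. P)) \<Longrightarrow> \<bar>f w\<bar> \<le> K"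
    and diff: "\<And>w i x. w \<in> space (PiM {..<N} (\<lambda>_. P)) \<Longrightarrow> i < N \<Longrightarrow> x \<in> space P
                 \<Longrightarrow> \<bar>f (w(i := x)) - f w\<bar> \<le> c"
    and s: "s > 0"
  shows "(\<integral>w. exp (s * (f w - (\<integral>w. f w \<partial>PiM {..<N} (\<lambda>_. P)))) \<partial>PiM {..<N} (\<lambda>_. P))
           \<le> exp (s\<^sup>2 * (real N * c\<^sup>2) / 8)"
  using f bound diff
proof (induction N arbitrary: f)
  case 0
  show ?case
    by (simp add: PiM_empty lebesgue_integral_count_space_finite)
next
  case (Suc N)
  interpret P: prob_space P by (rule P)
  interpret product_sigma_finite "\<lambda>_::nat. P" by unfold_locales
  let ?M = "PiM {..<N} (\<lambda>_. P)" and ?M' = "PiM {..<Suc N} (\<lambda>_. P)"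
  interpret M: prob_space ?M by (rule prob_space_PiM) (rule P)
  interpret M': prob_space ?M' by (rule prob_space_PiM) (rule P)
  have ins: "{..<Suc N} = insert N {..<N}" by auto
  have upd: "(\<lambda>(x, y). x(N := y)) \<in> measurable (?M \<Otimes>\<^sub>M P) ?M'"
    unfolding ins by measurable
  have upd_space: "x(N := y) \<in> space ?M'" if "x \<in> space ?M" "y \<in> space P" for x y
    using measurable_space[OF upd, of "(x, y)"] that by (auto simp: space_pair_measure)
  have f [measurable]: "f \<in> borel_measurable ?M'" and
    fb: "\<And>w. w \<in> space ?M' \<Longrightarrow> \<bar>f w\<bar> \<le> K"
    using Suc.prems by auto
  have fm [measurable]: "(\<lambda>(x, y). f (x(N := y))) \<in> borel_measurable (?M \<Otimes>\<^sub>M P)"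
    using measurable_compose[OF upd f] by (simp add: case_prod_beta')
  have fx [measurable]: "(\<lambda>y. f (x(N := y))) \<in> borel_measurable P" if "x \<in> space ?M" for x
    using measurable_compose[OF measurable_Pair1'[OF that] fm] by simp
  have fxi: "integrable P (\<lambda>y. f (x(N := y)))" if "x \<in> space ?M" for x
    using that fb upd_space by (intro P.integrable_const_bound[where B=K]) auto
  define g where "g = (\<lambda>x. \<integral>y. f (x(N := y)) \<partial>P)"
  have g [measurable]: "g \<in> borel_measurable ?M"
    unfolding g_def by measurable
  have gb: "\<bar>g x\<bar> \<le> K" if x: "x \<in> space ?M" for x
  proof -
    have "\<bar>g x\<bar> \<le> (\<integral>y. \<bar>f (x(N := y))\<bar> \<partial>P)"
      unfolding g_def by (rule integral_abs_bound)
    also have "\<dots> \<le> K"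
      using fb upd_space x fxi[OF x] by (intro P.integral_le_const) auto
    finally show ?thesis .
  qed
  have gd: "\<bar>g (x(i := z)) - g x\<bar> \<le> c" if x: "x \<in> space ?M" and i: "i < N" and z: "z \<in> space P" for x i z
  proof -
    have x': "x(i := z) \<in> space ?M"
      using x i z by (auto simp: space_PiM PiE_def extensional_def Pi_def)
    have "g (x(i := z)) - g x = (\<integral>y. f (x(i := z, N := y)) - f (x(N := y)) \<partial>P)"
      unfolding g_def using fxi[OF x] fxi[OF x'] by simp
    also have "\<bar>\<dots>\<bar> \<le> (\<integral>y. \<bar>f (x(i := z, N := y)) - f (x(N := y))\<bar> \<partial>P)"
      by (rule integral_abs_bound)
    also have "\<dots> \<le> c"
    proof (rule P.integral_le_const)
      show "AE y in P. \<bar>f (x(i := z, N := y)) - f (x(N := y))\<bar> \<le> c"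
      proof (rule AE_I2)
        fix y assume y: "y \<in> space P"
        have twist: "x(i := z, N := y) = x(N := y, i := z)"
          using i by (intro fun_upd_twist) auto
        show "\<bar>f (x(i := z, N := y)) - f (x(N := y))\<bar> \<le> c"
          unfolding twist using i z by (intro Suc.prems(3) upd_space x y) auto
      qed
    qed (use fxi[OF x] fxi[OF x'] in simp)
    finally show ?thesis .
  qed
  define m where "m = (\<integral>w. f w \<partial>?M')"
  have fi: "integrable ?M' f"
    using fb by (intro M'.integrable_const_bound[where B=K]) auto
  have m: "m = (\<integral>x. g x \<partial>?M)"
    unfolding m_def g_def ins using fi by (intro product_integral_insert) (auto simp: ins)
  have exp_b: "exp (s * (f w - m)) \<le> exp (s * (K - m))" if "w \<in> space ?M'" for w
    using fb[OF that] s by (simp add: abs_le_iff)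
  have "(\<integral>w. exp (s * (f w - m)) \<partial>?M') = (\<integral>x. \<integral>y. exp (s * (f (x(N := y)) - m)) \<partial>P \<partial>?M)"
    unfolding ins using exp_b
    by (intro product_integral_insert)
       (auto simp flip: ins intro!: M'.integrable_const_bound[where B="exp (s * (K - m))"])
  also have "\<dots> \<le> (\<integral>x. exp (s * (g x - m)) * exp (s\<^sup>2 * c\<^sup>2 / 8) \<partial>?M)"
  proof (rule integral_mono)
    show "integrable ?M (\<lambda>x. \<integral>y. exp (s * (f (x(N := y)) - m)) \<partial>P)"
    proof (rule M.integrable_const_bound[where B="exp (s * (K - m))"])
      show "AE x in ?M. norm (\<integral>y. exp (s * (f (x(N := y)) - m)) \<partial>P) \<le> exp (s * (K - m))"
      proof (rule AE_I2)
        fix x assume x: "x \<in> space ?M"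
        have "(\<integral>y. exp (s * (f (x(N := y)) - m)) \<partial>P) \<le> exp (s * (K - m))"
          using x exp_b upd_space
          by (intro P.integral_le_const P.integrable_const_bound[where B="exp (s * (K - m))"]) auto
        then show "norm (\<integral>y. exp (s * (f (x(N := y)) - m)) \<partial>P) \<le> exp (s * (K - m))"
          by (simp add: abs_of_nonneg)
      qed
    qed measurable
    show "integrable ?M (\<lambda>x. exp (s * (g x - m)) * exp (s\<^sup>2 * c\<^sup>2 / 8))"
      using gb s
      by (intro integrable_mult_left M.integrable_const_bound[where B="exp (s * (K - m))"])
         (auto simp: abs_le_iff)
    fix x assume x: "x \<in> space ?M"
    \<comment> \<open>Split f - m into (g - m) + (f - g). With \<open>x\<close> frozen, the second
      bracket is centred and has oscillation at most \<open>c\<close>; the first is left to the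
      induction hypothesis.\<close>
    have "(\<integral>y. exp (s * (f (x(N := y)) - m)) \<partial>P)
        = (\<integral>y. exp (s * (g x - m)) * exp (s * (f (x(N := y)) - g x)) \<partial>P)"
      by (simp add: algebra_simps flip: exp_add)
    also have "\<dots> = exp (s * (g x - m)) * (\<integral>y. exp (s * (f (x(N := y)) - g x)) \<partial>P)"
      by simp
    also have "(\<integral>y. exp (s * (f (x(N := y)) - g x)) \<partial>P) \<le> exp (s\<^sup>2 * c\<^sup>2 / 8)"
      unfolding g_def
    proof (rule P.Hoeffding_mgf)
      fix y z assume "y \<in> space P" "z \<in> space P"
      then have "\<bar>f (x(N := z, N := y)) - f (x(N := z))\<bar> \<le> c"
        by (intro Suc.prems(3) upd_space x) auto
      then show "f (x(N := y)) - f (x(N := z)) \<le> c"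
        unfolding fun_upd_upd by linarith
    qed (use x s in auto)
    finally show "(\<integral>y. exp (s * (f (x(N := y)) - m)) \<partial>P) \<le> exp (s * (g x - m)) * exp (s\<^sup>2 * c\<^sup>2 / 8)"
      by simp
  qed
  also have "\<dots> = (\<integral>x. exp (s * (g x - m)) \<partial>?M) * exp (s\<^sup>2 * c\<^sup>2 / 8)"
    by simp
  also have "(\<integral>x. exp (s * (g x - m)) \<partial>?M) \<le> exp (s\<^sup>2 * (real N * c\<^sup>2) / 8)"
    unfolding m using Suc.IH[OF g gb gd] by simp
  finally have "(\<integral>w. exp (s * (f w - m)) \<partial>?M')
      \<le> exp (s\<^sup>2 * (real N * c\<^sup>2) / 8) * exp (s\<^sup>2 * c\<^sup>2 / 8)"
    by simp
  also have "\<dots> = exp (s\<^sup>2 * (real (Suc N) * c\<^sup>2) / 8)"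
    by (simp add: field_simps flip: exp_add)
  finally show ?case
    unfolding m_def .
qed

lemma McDiarmid_inequality:
  fixes f :: "(nat \<Rightarrow> 'a) \<Rightarrow> real"
  assumes P: "prob_space P"
    and f [measurable]: "f \<in> borel_measurable (PiM {..<N} (\<lambda>_. P))"
    and bound: "\<And>w. w \<in> space (PiM {..<N} (\<lambda>_. P)) \<Longrightarrow> \<bar>f w\<bar> \<le> K"
    and diff: "\<And>w i x. w \<in> space (PiM {..<N} (\<lambda>_. P)) \<Longrightarrow> i < N \<Longrightarrow> x \<in> space P
                 \<Longrightarrow> \<bar>f (w(i := x)) - f w\<bar> \<le> c"
    and c: "c > 0" and N: "N > 0" and t: "t > 0"
  shows "measure (PiM {..<N} (\<lambda>_. P))
            {w \<in> space (PiM {..<N} (\<lambda>_. P)). f w - (\<integral>w. f w \<partial>PiM {..<N} (\<lambda>_. P)) \<ge> t}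
         \<le> exp (- 2 * t\<^sup>2 / (real N * c\<^sup>2))"
proof -
  let ?M = "PiM {..<N} (\<lambda>_. P)"
  interpret M: prob_space ?M by (rule prob_space_PiM) (rule P)
  define m where "m = (\<integral>w. f w \<partial>?M)"
  \<comment> \<open>The minimizer of
    \<open>- s * t + s\<^sup>2 * (real N * c\<^sup>2) / 8\<close>.\<close>
  define s where "s = 4 * t / (real N * c\<^sup>2)"
  have s: "s > 0" unfolding s_def using c N t by simp
  have "integrable ?M (\<lambda>w. exp (s * (f w - m)))"
    using bound s by (intro M.integrable_const_bound[where B="exp (s * (K - m))"]) (auto simp: abs_le_iff)
  then have "measure ?M {w \<in> space ?M. f w - m \<ge> t}
      \<le> exp (- s * t) * (LINT w:space ?M|?M. exp (s * (f w - m)))"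
    by (intro M.Chernoff_ineq_ge s) (auto simp: set_integrable_def simp del: real_scaleR_def intro!: integrable_mult_indicator)
  also have "(LINT w:space ?M|?M. exp (s * (f w - m))) = (\<integral>w. exp (s * (f w - m)) \<partial>?M)"
    by (simp add: set_lebesgue_integral_def cong: Bochner_Integration.integral_cong)
  also have "\<dots> \<le> exp (s\<^sup>2 * (real N * c\<^sup>2) / 8)"
    unfolding m_def by (rule McDiarmid_mgf[OF P f bound diff s])
  finally have "measure ?M {w \<in> space ?M. f w - m \<ge> t} \<le> exp (- s * t + s\<^sup>2 * (real N * c\<^sup>2) / 8)"
    by (simp flip: exp_add)
  also have "- s * t + s\<^sup>2 * (real N * c\<^sup>2) / 8 = - 2 * t\<^sup>2 / (real N * c\<^sup>2)"
    unfolding s_def using c N by (simp add: field_simps power2_eq_square)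
  finally show ?thesis unfolding m_def .
qed

section \<open>Maxima of sub-Gaussian variables and chaining\<close>

text \<open>The value s = \<open>sqrt (2 * a) / \<sigma>\<close> makes the two terms on the right
  equal. It is not a positive number if \<open>a\<close> or \<sigma> vanishes; the case a = 0 does
  occur, as the logarithm of the size of a one-point index set.\<close>

lemma optimize_subgaussian:
  fixes m a \<sigma> :: real
  assumes a: "a \<ge> 0" and \<sigma>: "\<sigma> \<ge> 0" and *: "\<And>s. s > 0 \<Longrightarrow> s * m \<le> a + s\<^sup>2 * \<sigma>\<^sup>2 / 2"
  shows "m \<le> \<sigma> * sqrt (2 * a)"
proof (cases "\<sigma> = 0 \<or> a = 0")
  case True
  have "m \<le> 0"
  proof (rule ccontr)
    assume m: "\<not> m \<le> 0"
    show False
    proof (cases "\<sigma> = 0")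
      case True
      then show False
        using *[of "(a + 1) / m"] m a by simp
    next
      case False
      then have "a = 0" using \<open>\<sigma> = 0 \<or> a = 0\<close> by simp
      then show False
        using *[of "m / \<sigma>\<^sup>2"] m False \<sigma> by (simp add: field_simps power2_eq_square)
    qed
  qed
  then show ?thesis using True by auto
next
  case False
  then have pos: "\<sigma> > 0" "sqrt (2 * a) > 0" using a \<sigma> by auto
  have "sqrt (2 * a) / \<sigma> * m \<le> a + (sqrt (2 * a) / \<sigma>)\<^sup>2 * \<sigma>\<^sup>2 / 2"
    using pos by (intro *) simp
  also have "\<dots> = 2 * a"
    using pos a by (simp add: power_divide)
  also have "\<dots> = sqrt (2 * a) * sqrt (2 * a)"
    using a by simp
  finally have "sqrt (2 * a) * m \<le> sqrt (2 * a) * (\<sigma> * sqrt (2 * a))"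
    using pos by (simp add: field_simps)
  then show ?thesis
    using pos by simp
qed

context prob_space
begin

lemma integrable_Max:
  fixes Y :: "'i \<Rightarrow> 'a \<Rightarrow> real"
  assumes I: "finite I" "I \<noteq> {}" and Y: "\<And>i. i \<in> I \<Longrightarrow> Y i \<in> borel_measurable M"
    and b: "\<And>i x. i \<in> I \<Longrightarrow> x \<in> space M \<Longrightarrow> \<bar>Y i x\<bar> \<le> K"
  shows "integrable M (\<lambda>x. Max ((\<lambda>i. Y i x) ` I))"
proof (rule integrable_const_bound[where B=K])
  show "(\<lambda>x. Max ((\<lambda>i. Y i x) ` I)) \<in> borel_measurable M"
    by (rule borel_measurable_Max[OF I(1) Y])
  show "AE x in M. norm (Max ((\<lambda>i. Y i x) ` I)) \<le> K"
  proof (rule AE_I2)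
    fix x assume x: "x \<in> space M"
    have "Max ((\<lambda>i. Y i x) ` I) \<in> (\<lambda>i. Y i x) ` I"
      using I by (intro Max_in) auto
    then show "norm (Max ((\<lambda>i. Y i x) ` I)) \<le> K"
      using b x by auto
  qed
qed

text \<open>The exponential of a maximum is at most the sum of the exponentials, so no independence
  between the variables is required. The parameter s is optimized only at the end.\<close>

lemma expectation_Max_le:
  fixes Y :: "'i \<Rightarrow> 'a \<Rightarrow> real"
  assumes I: "finite I" "I \<noteq> {}" and Y: "\<And>i. i \<in> I \<Longrightarrow> Y i \<in> borel_measurable M"
    and b: "\<And>i x. i \<in> I \<Longrightarrow> x \<in> space M \<Longrightarrow> \<bar>Y i x\<bar> \<le> K"
    and \<sigma>: "\<sigma> \<ge> 0"
    and mgf: "\<And>i s. i \<in> I \<Longrightarrow> s > 0 \<Longrightarrow> expectation (\<lambda>x. exp (s * Y i x)) \<le> exp (s\<^sup>2 * \<sigma>\<^sup>2 / 2)"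
  shows "expectation (\<lambda>x. Max ((\<lambda>i. Y i x) ` I)) \<le> \<sigma> * sqrt (2 * ln (card I))"
proof (rule optimize_subgaussian)
  have card: "card I \<ge> 1" using I by (simp add: Suc_leI card_gt_0_iff)
  show "0 \<le> ln (real (card I))" using card by simp
  define Z where "Z = (\<lambda>x. Max ((\<lambda>i. Y i x) ` I))"
  have Zi: "integrable M Z"
    unfolding Z_def by (rule integrable_Max[OF I Y b])
  define m where "m = expectation Z"
  fix s :: real assume s: "s > 0"
  have ei: "integrable M (\<lambda>x. exp (s * Y i x))" if "i \<in> I" for i
    using Y[OF that] b[OF that] s
    by (intro integrable_const_bound[where B="exp (s * K)"]) (auto simp: abs_le_iff)
  \<comment> \<open>Jensen's inequality done by hand: the tangent of the exponential at s * m lies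
    below it, and its linear term has mean zero.\<close>
  have "exp (s * m) = expectation (\<lambda>x. exp (s * m) * (1 + s * (Z x - m)))"
    using Zi prob_space by (simp add: m_def)
  also have "\<dots> \<le> expectation (\<lambda>x. \<Sum>i\<in>I. exp (s * Y i x))"
  proof (rule integral_mono)
    show "integrable M (\<lambda>x. exp (s * m) * (1 + s * (Z x - m)))"
      using Zi by simp
    show "integrable M (\<lambda>x. \<Sum>i\<in>I. exp (s * Y i x))"
      using ei by simp
    fix x
    have "exp (s * m) * (1 + s * (Z x - m)) \<le> exp (s * m) * exp (s * (Z x - m))"
      by (intro mult_left_mono exp_ge_add_one_self) simp
    also have "\<dots> = exp (s * Z x)"
      by (simp add: algebra_simps flip: exp_add)
    also have "\<dots> \<le> (\<Sum>i\<in>I. exp (s * Y i x))"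
    proof -
      have "Z x \<in> (\<lambda>i. Y i x) ` I"
        unfolding Z_def using I by (intro Max_in) auto
      then obtain i where i: "i \<in> I" "Z x = Y i x" by auto
      have "exp (s * Y i x) \<le> (\<Sum>i\<in>I. exp (s * Y i x))"
        using I i(1) by (intro member_le_sum) auto
      then show ?thesis by (simp add: i)
    qed
    finally show "exp (s * m) * (1 + s * (Z x - m)) \<le> (\<Sum>i\<in>I. exp (s * Y i x))" .
  qed
  also have "\<dots> = (\<Sum>i\<in>I. expectation (\<lambda>x. exp (s * Y i x)))"
    using ei by (intro Bochner_Integration.integral_sum) auto
  also have "\<dots> \<le> real (card I) * exp (s\<^sup>2 * \<sigma>\<^sup>2 / 2)"
    using mgf[OF _ s] by (intro sum_bounded_above)
  also have "\<dots> = exp (ln (real (card I)) + s\<^sup>2 * \<sigma>\<^sup>2 / 2)"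
    using card by (simp add: exp_add)
  finally show "s * expectation (\<lambda>x. Max ((\<lambda>i. Y i x) ` I)) \<le> ln (real (card I)) + s\<^sup>2 * \<sigma>\<^sup>2 / 2"
    by (simp add: m_def Z_def)
qed (rule \<sigma>)

text \<open>A point of the finer level is its link in the coarser level plus an increment, so
  passing to the next level costs at most the expected maximum of the increments. The chain stops at
  a finite level, which avoids limits and separability.\<close>

lemma expectation_Max_chain:
  fixes X :: "'t \<Rightarrow> 'a \<Rightarrow> real" and T :: "nat \<Rightarrow> 't set" and \<pi> :: "nat \<Rightarrow> 't \<Rightarrow> 't"
  assumes T: "\<And>k. finite (T k)" "\<And>k. T k \<noteq> {}" "\<And>k. T k \<subseteq> U"
    and X: "\<And>t. t \<in> U \<Longrightarrow> X t \<in> borel_measurable M"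
    and b: "\<And>t x. t \<in> U \<Longrightarrow> x \<in> space M \<Longrightarrow> \<bar>X t x\<bar> \<le> K"
    and \<pi>: "\<And>k t. t \<in> T (Suc k) \<Longrightarrow> \<pi> k t \<in> T k"
    and \<sigma>: "\<And>k. \<sigma> k \<ge> 0"
    and mgf: "\<And>k t s. t \<in> T (Suc k) \<Longrightarrow> s > 0 \<Longrightarrow>
       expectation (\<lambda>x. exp (s * (X t x - X (\<pi> k t) x))) \<le> exp (s\<^sup>2 * (\<sigma> k)\<^sup>2 / 2)"
  shows "expectation (\<lambda>x. Max ((\<lambda>t. X t x) ` T n))
      \<le> expectation (\<lambda>x. Max ((\<lambda>t. X t x) ` T 0)) + (\<Sum>k<n. \<sigma> k * sqrt (2 * ln (card (T (Suc k)))))"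
proof (induction n)
  case 0
  show ?case by simp
next
  case (Suc n)
  let ?S = "\<lambda>k x. Max ((\<lambda>t. X t x) ` T k)"
  let ?D = "\<lambda>x. Max ((\<lambda>t. X t x - X (\<pi> n t) x) ` T (Suc n))"
  have TU: "t \<in> U" if "t \<in> T k" for k t using T(3) that by blast
  have S: "integrable M (?S k)" for k
    using TU by (intro integrable_Max[where K=K] T X b)
  have Db: "\<bar>X t x - X (\<pi> n t) x\<bar> \<le> 2 * K" if "t \<in> T (Suc n)" "x \<in> space M" for t x
    using b[OF TU[OF that(1)] that(2)] b[OF TU[OF \<pi>[OF that(1)]] that(2)] by linarith
  have Dm: "(\<lambda>x. X t x - X (\<pi> n t) x) \<in> borel_measurable M" if "t \<in> T (Suc n)" for t
    using X[OF TU[OF that]] X[OF TU[OF \<pi>[OF that]]] by simp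
  have D: "integrable M ?D"
    by (rule integrable_Max[OF T(1,2) Dm Db])
  have "expectation (?S (Suc n)) \<le> expectation (\<lambda>x. ?S n x + ?D x)"
  proof (rule integral_mono)
    fix x
    have "X t x \<le> ?S n x + ?D x" if t: "t \<in> T (Suc n)" for t
    proof -
      have "X (\<pi> n t) x \<le> ?S n x"
        using T \<pi>[OF t] by (intro Max_ge) auto
      moreover have "X t x - X (\<pi> n t) x \<le> ?D x"
        using T t by (intro Max_ge) auto
      ultimately show ?thesis by simp
    qed
    then show "?S (Suc n) x \<le> ?S n x + ?D x"
      using T by (subst Max_le_iff) auto
  qed (use S D in auto)
  also have "\<dots> = expectation (?S n) + expectation ?D"
    using S D by simp
  also have "expectation ?D \<le> \<sigma> n * sqrt (2 * ln (card (T (Suc n))))"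
    by (rule expectation_Max_le[OF T(1,2) Dm Db \<sigma> mgf])
  finally show ?case using Suc.IH by simp
qed

end

section \<open>Deviations of sample means\<close>

definition dev :: "'z::topological_space measure \<Rightarrow> nat \<Rightarrow> ('z \<Rightarrow> real) \<Rightarrow> (nat \<Rightarrow> 'z) \<Rightarrow> real" where
  "dev P N h w = (\<integral>z. h z \<partial>P) - (\<Sum>i<N. h (w i)) / real N"

context
  fixes P :: "'z::topological_space measure" and N :: nat
  assumes P: "prob_space P" "sets P = sets borel" and N: "N \<ge> 1"
begin

lemma measurable_borel_base: "h \<in> borel_measurable borel \<Longrightarrow> h \<in> borel_measurable P"
  using measurable_cong_sets[OF P(2) refl] by blast

lemma integrable_base:
  fixes h :: "'z \<Rightarrow> real"
  assumes "h \<in> borel_measurable borel" "\<And>z. \<bar>h z\<bar> \<le> K"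
  shows "integrable P h"
proof -
  interpret prob_space P by (rule P)
  show ?thesis
    using assms measurable_borel_base by (intro integrable_const_bound[where B=K]) auto
qed

lemma measurable_dev:
  assumes "h \<in> borel_measurable borel"
  shows "dev P N h \<in> borel_measurable (PiM {..<N} (\<lambda>_. P))"
proof -
  have "(\<lambda>w. h (w i)) \<in> borel_measurable (PiM {..<N} (\<lambda>_. P))" if "i < N" for i
    using that by (intro measurable_compose[OF _ measurable_borel_base[OF assms]]) measurable
  then show ?thesis
    unfolding dev_def[abs_def] by measurable
qed

lemma dev_diff:
  assumes "g \<in> borel_measurable borel" "\<And>z. \<bar>g z\<bar> \<le> K" "h \<in> borel_measurable borel" "\<And>z. \<bar>h z\<bar> \<le> K"
  shows "dev P N (\<lambda>z. g z - h z) w = dev P N g w - dev P N h w"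
  using integrable_base[OF assms(1,2)] integrable_base[OF assms(3,4)]
  by (simp add: dev_def sum_subtractf diff_divide_distrib)

lemma dev_bound:
  assumes h: "h \<in> borel_measurable borel" "\<And>z. \<bar>h z\<bar> \<le> a"
  shows "\<bar>dev P N h w\<bar> \<le> 2 * a"
proof -
  interpret prob_space P by (rule P)
  have "\<bar>\<integral>z. h z \<partial>P\<bar> \<le> (\<integral>z. \<bar>h z\<bar> \<partial>P)"
    by (rule integral_abs_bound)
  also have "\<dots> \<le> a"
    using integrable_base[OF h] h(2) by (intro integral_le_const) auto
  finally have 1: "\<bar>\<integral>z. h z \<partial>P\<bar> \<le> a" .
  have "\<bar>\<Sum>i<N. h (w i)\<bar> \<le> (\<Sum>i<N. a)"
    using h(2) by (intro order_trans[OF sum_abs] sum_mono) auto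
  then have "\<bar>(\<Sum>i<N. h (w i)) / real N\<bar> \<le> a"
    using N by (simp add: field_simps)
  then show ?thesis
    using 1 unfolding dev_def by linarith
qed

lemma dev_update:
  assumes h: "\<And>x y. \<bar>h x - h y\<bar> \<le> c" and i: "i < N"
  shows "\<bar>dev P N h (w(i := x)) - dev P N h w\<bar> \<le> c / real N"
proof -
  have "(\<Sum>j<N. h ((w(i := x)) j)) = h x + (\<Sum>j\<in>{..<N} - {i}. h ((w(i := x)) j))"
    using i by (simp add: sum.remove[where x=i])
  also have "(\<Sum>j\<in>{..<N} - {i}. h ((w(i := x)) j)) = (\<Sum>j\<in>{..<N} - {i}. h (w j))"
    by (rule sum.cong) auto
  finally have "(\<Sum>j<N. h ((w(i := x)) j)) - (\<Sum>j<N. h (w j)) = h x - h (w i)"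
    using i by (simp add: sum.remove[where x=i and A="{..<N}"])
  then have "(\<Sum>j<N. h (w j)) - (\<Sum>j<N. h ((w(i := x)) j)) = h (w i) - h x"
    by linarith
  then have "dev P N h (w(i := x)) - dev P N h w = (h (w i) - h x) / real N"
    by (simp add: dev_def flip: diff_divide_distrib)
  then show ?thesis
    using h[of "w i" x] N by (simp add: divide_right_mono)
qed

lemma expectation_dev:
  assumes h: "h \<in> borel_measurable borel" "\<And>z. \<bar>h z\<bar> \<le> a"
  shows "(\<integral>w. dev P N h w \<partial>PiM {..<N} (\<lambda>_. P)) = 0"
proof -
  let ?M = "PiM {..<N} (\<lambda>_. P)"
  interpret M: prob_space ?M by (rule prob_space_PiM) (rule P)
  have c: "(\<lambda>w. w i) \<in> measurable ?M P" if "i < N" for i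
    using that by (intro measurable_component_singleton) simp
  have meas: "(\<lambda>w. h (w i)) \<in> borel_measurable ?M" if "i < N" for i
    by (rule measurable_compose[OF c[OF that] measurable_borel_base[OF h(1)]])
  have int: "integrable ?M (\<lambda>w. h (w i))" if "i < N" for i
    using h(2) meas[OF that] by (intro M.integrable_const_bound[where B=a]) auto
  have eq: "(\<integral>w. h (w i) \<partial>?M) = (\<integral>z. h z \<partial>P)" if "i < N" for i
    using integral_distr[OF c[OF that] measurable_borel_base[OF h(1)]] that
      distr_PiM_component[of "{..<N}" "\<lambda>_. P" i] P(1) by simp
  have "(\<integral>w. dev P N h w \<partial>?M) = (\<integral>z. h z \<partial>P) - (\<Sum>i<N. \<integral>w. h (w i) \<partial>?M) / real N"
  proof -
    have "integrable ?M (\<lambda>w. \<Sum>i<N. h (w i))"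
      using int by (intro Bochner_Integration.integrable_sum) simp
    moreover have "(\<integral>w. (\<Sum>i<N. h (w i)) \<partial>?M) = (\<Sum>i<N. \<integral>w. h (w i) \<partial>?M)"
      using int by (intro Bochner_Integration.integral_sum) simp
    ultimately show ?thesis
      unfolding dev_def using M.prob_space by (simp add: Bochner_Integration.integral_diff)
  qed
  then show ?thesis
    using N eq by simp
qed

text \<open>A uniform bound a allows oscillation 2 * a, hence a change of 2 * a / N per coordinate;
  the McDiarmid exponent then becomes that of a sub-Gaussian variable with parameter
  \<open>a / sqrt N\<close>.\<close>

lemma dev_mgf:
  assumes h: "h \<in> borel_measurable borel" "\<And>z. \<bar>h z\<bar> \<le> a" and s: "s > 0"
  shows "(\<integral>w. exp (s * dev P N h w) \<partial>PiM {..<N} (\<lambda>_. P)) \<le> exp (s\<^sup>2 * (a / sqrt N)\<^sup>2 / 2)"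
proof -
  have osc: "\<bar>h x - h y\<bar> \<le> 2 * a" for x y
    using h(2)[of x] h(2)[of y] by linarith
  have "(\<integral>w. exp (s * dev P N h w) \<partial>PiM {..<N} (\<lambda>_. P)) \<le> exp (s\<^sup>2 * (real N * (2 * a / real N)\<^sup>2) / 8)"
    using McDiarmid_mgf[OF P(1) measurable_dev[OF h(1)] dev_bound[OF h] dev_update[OF osc] s]
    by (simp add: expectation_dev[OF h])
  also have "s\<^sup>2 * (real N * (2 * a / real N)\<^sup>2) / 8 = s\<^sup>2 * (a / sqrt N)\<^sup>2 / 2"
    using N by (simp add: field_simps power2_eq_square)
  finally show ?thesis .
qed

end

lemma empirical_properties:
  fixes h :: "'z::topological_space \<Rightarrow> real"
  assumes N: "N \<ge> 1"
  shows "prob_space (empirical N w)" "sets (empirical N w) = sets borel"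
    and "h \<in> borel_measurable borel \<Longrightarrow> (\<integral>z. h z \<partial>empirical N w) = (\<Sum>i<N. h (w i)) / real N"
proof -
  let ?U = "uniform_measure (count_space {..<N}) {..<N}"
  have U: "?U = uniform_count_measure {..<N}"
    using N
    by (intro measure_eqI)
       (auto simp: emeasure_uniform_count_measure emeasure_count_space finite_subset Int_absorb1
         divide_ennreal ennreal_of_nat_eq_real_of_nat sets_uniform_count_measure)
  \<comment> \<open>All sets of indices are measurable, so any sample \<open>w\<close> may be pushed
    forward.\<close>
  have w: "w \<in> measurable ?U borel"
    by (simp add: measurable_def)
  have "{..<N} \<noteq> {}" using N by (auto simp: lessThan_empty_iff)
  then have "prob_space ?U"
    unfolding U by (intro prob_space_uniform_count_measure) auto
  then show "prob_space (empirical N w)"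
    unfolding empirical_def using w by (rule prob_space.prob_space_distr)
  show "sets (empirical N w) = sets borel"
    by (simp add: empirical_def)
  show "(\<integral>z. h z \<partial>empirical N w) = (\<Sum>i<N. h (w i)) / real N" if "h \<in> borel_measurable borel"
    unfolding empirical_def integral_distr[OF w that] unfolding U
    by (simp add: integral_uniform_count_measure)
qed

section \<open>Nets for the dual class\<close>

text \<open>A finite covering number is attained, because extended naturals are well ordered. The
  uniform distance is also unfolded into a pointwise bound, the form needed for perturbing
  \<open>c_transform\<close>.\<close>

lemma cover_num_cover:
  assumes F: "\<And>l z. l \<in> F \<Longrightarrow> 0 \<le> l z \<and> l z \<le> B" and n: "cover_num F v = enat n"
  obtains C where "finite C" "card C = n" "C \<subseteq> F" "\<And>l. l \<in> F \<Longrightarrow> \<exists>c\<in>C. \<forall>z. \<bar>l z - c z\<bar> \<le> v"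
proof -
  let ?S = "{enat (card C) | C. finite C \<and> C \<subseteq> F \<and> (\<forall>l\<in>F. \<exists>c\<in>C. (SUP z. \<bar>l z - c z\<bar>) \<le> v)}"
  have "?S \<noteq> {}"
    using n unfolding cover_num_def by (metis Inf_enat_def enat.distinct(2) infinity_enat_def)
  then have "cover_num F v \<in> ?S"
    unfolding cover_num_def by (metis (no_types, lifting) wellorder_InfI ex_in_conv)
  then obtain C where C: "finite C" "card C = n" "C \<subseteq> F"
      "\<And>l. l \<in> F \<Longrightarrow> \<exists>c\<in>C. (SUP z. \<bar>l z - c z\<bar>) \<le> v"
    using n by auto
  show thesis
  proof (rule that[OF C(1-3)])
    fix l assume l: "l \<in> F"
    then obtain c where c: "c \<in> C" "(SUP z. \<bar>l z - c z\<bar>) \<le> v"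
      using C(4) by blast
    \<comment> \<open>A real supremum dominates its members only if the range is bounded above; the
      common range of the losses guarantees this.\<close>
    have "\<bar>l z - c z\<bar> \<le> B" for z
      using F[OF l, of z] F[of c z] c(1) C(3) by (auto simp: abs_le_iff)
    then have "bdd_above (range (\<lambda>z. \<bar>l z - c z\<bar>))"
      by (intro bdd_aboveI2)
    then have "\<bar>l z - c z\<bar> \<le> v" for z
      using cSUP_upper[of z UNIV "\<lambda>z. \<bar>l z - c z\<bar>"] c(2) by (meson UNIV_I order_trans)
    then show "\<exists>c\<in>C. \<forall>z. \<bar>l z - c z\<bar> \<le> v"
      using c(1) by blast
  qed
qed

lemma cover_num_antimono:
  assumes "u \<le> v"
  shows "cover_num F v \<le> cover_num F u"
  unfolding cover_num_def
proof (rule Inf_superset_mono)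
  show "{enat (card C) | C. finite C \<and> C \<subseteq> F \<and> (\<forall>l\<in>F. \<exists>c\<in>C. (SUP z. \<bar>l z - c z\<bar>) \<le> u)}
      \<subseteq> {enat (card C) | C. finite C \<and> C \<subseteq> F \<and> (\<forall>l\<in>F. \<exists>c\<in>C. (SUP z. \<bar>l z - c z\<bar>) \<le> v)}"
    using assms by (smt (verit) Collect_mono order_trans)
qed

lemma entropy_antimono:
  assumes "u \<le> v"
  shows "entropy F v \<le> entropy F u"
proof (cases "cover_num F u")
  case (enat m)
  then obtain n where n: "cover_num F v = enat n" "n \<le> m"
    using cover_num_antimono[OF assms, of F] enat_ile by fastforce
  \<comment> \<open>An empty cover is possible only for an empty class; its entropy is zero by the
    convention \<open>ln 0 = 0\<close>, so monotonicity survives.\<close>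
  have "ln (real n) \<le> ln (real m)"
    using n(2) by (cases "n = 0"; cases "m = 0") auto
  then show ?thesis
    using enat n by (simp add: entropy_def ennreal_leI)
next
  case infinity
  then show ?thesis by (simp add: entropy_def)
qed

text \<open>Each dyadic scale is charged to the next dyadic interval, where the entropy is at least as large.\<close>
lemma dyadic_entropy_sum_le:
  assumes d: "d > 0"
  shows "(\<Sum>k<n. entropy F (d / 2 ^ Suc k) * ennreal (d / 2 ^ (k + 2))) \<le> dudley F"
proof -
  define a where "a = (\<lambda>k. d / 2 ^ Suc k)"
  have a_dec: "a (Suc k) \<le> a k" and a_pos: "a k > 0" and a_diff: "a k - a (Suc k) = d / 2 ^ (k + 2)" for k
    using d by (auto simp: a_def field_simps)
  have pw: "(\<Sum>k<n. entropy F (a k) * indicator {a (Suc k)<..a k} v) \<le> entropy F v * indicator {a n<..} v" for n v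
  proof (induction n)
    case 0
    show ?case by simp
  next
    case (Suc n)
    show ?case
    proof (cases "a n < v")
      case True
      then have "a (Suc n) < v" using a_dec[of n] by linarith
      then show ?thesis using Suc True by simp
    next
      case False
      then have "entropy F (a n) * indicator {a (Suc n)<..a n} v \<le> entropy F v * indicator {a (Suc n)<..} v"
        using entropy_antimono[of v "a n" F] by (auto simp: indicator_def)
      then show ?thesis using Suc False by simp
    qed
  qed
  have "(\<Sum>k<n. entropy F (a k) * ennreal (d / 2 ^ (k + 2)))
      = (\<Sum>k<n. entropy F (a k) * emeasure lborel {a (Suc k)<..a k})"
    using a_dec by (simp add: a_diff)
  also have "\<dots> = (\<Sum>k<n. \<integral>\<^sup>+v. entropy F (a k) * indicator {a (Suc k)<..a k} v \<partial>lborel)"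
    by (simp add: nn_integral_cmult_indicator)
  also have "\<dots> = (\<integral>\<^sup>+v. (\<Sum>k<n. entropy F (a k) * indicator {a (Suc k)<..a k} v) \<partial>lborel)"
    by (intro nn_integral_sum[symmetric]) measurable
  also have "\<dots> \<le> (\<integral>\<^sup>+v. entropy F v * indicator {a n<..} v \<partial>lborel)"
    by (intro nn_integral_mono pw)
  also have "\<dots> \<le> dudley F"
    unfolding dudley_def using a_pos[of n]
    by (intro nn_integral_mono mult_left_mono) (auto simp: indicator_def)
  finally show ?thesis by (simp add: a_def)
qed

text \<open>A finite entropy integral forces finite covers at every scale: infinite entropy at one
  scale persists at all smaller ones, hence on an interval of positive length.\<close>

lemma dyadic_covers:
  assumes F: "\<And>l z. l \<in> F \<Longrightarrow> 0 \<le> l z \<and> l z \<le> B" and d: "d > 0" and J: "dudley F < \<infinity>"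
  obtains C :: "nat \<Rightarrow> ('z \<Rightarrow> real) set" where
    "\<And>k. finite (C k)" "\<And>k. C k \<subseteq> F"
    "\<And>k l. l \<in> F \<Longrightarrow> \<exists>c\<in>C k. \<forall>z. \<bar>l z - c z\<bar> \<le> d / 2 ^ Suc k"
    "\<And>n. (\<Sum>k<n. d / 2 ^ (k + 2) * sqrt (ln (card (C k)))) \<le> enn2real (dudley F)"
proof -
  let ?a = "\<lambda>k. d / 2 ^ Suc k"
  have "\<exists>m. cover_num F (?a k) = enat m" for k
  proof (cases "cover_num F (?a k)")
    case infinity
    then have "entropy F (?a k) * ennreal (d / 2 ^ (k + 2)) = \<infinity>"
      using d by (simp add: entropy_def ennreal_top_mult)
    moreover have "entropy F (?a k) * ennreal (d / 2 ^ (k + 2)) \<le> (\<Sum>k<Suc k. entropy F (?a k) * ennreal (d / 2 ^ (k + 2)))"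
      by (rule member_le_sum) auto
    ultimately have "dudley F = \<infinity>"
      using dyadic_entropy_sum_le[OF d, of F "Suc k"] by (metis infinity_ennreal_def neq_top_trans)
    then show ?thesis using J by simp
  qed auto
  then obtain m where m: "\<And>k. cover_num F (?a k) = enat (m k)" by metis
  have "\<exists>C. finite C \<and> card C = m k \<and> C \<subseteq> F \<and> (\<forall>l\<in>F. \<exists>c\<in>C. \<forall>z. \<bar>l z - c z\<bar> \<le> ?a k)" for k
  proof (rule cover_num_cover[of F B, OF _ m[of k]])
    fix C assume "finite C" "card C = m k" "C \<subseteq> F" "\<And>l. l \<in> F \<Longrightarrow> \<exists>c\<in>C. \<forall>z. \<bar>l z - c z\<bar> \<le> ?a k"
    then show ?thesis by (intro exI[of _ C]) simp
  qed (rule F)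
  then obtain C where C: "\<And>k. finite (C k)" "\<And>k. card (C k) = m k" "\<And>k. C k \<subseteq> F"
    "\<And>k l. l \<in> F \<Longrightarrow> \<exists>c\<in>C k. \<forall>z. \<bar>l z - c z\<bar> \<le> ?a k"
    by metis
  show thesis
  proof (rule that[OF C(1,3,4)])
    fix n
    have ln0: "0 \<le> ln (real (card (C k)))" for k
      by (cases "card (C k) = 0") auto
    have e: "entropy F (?a k) = ennreal (sqrt (ln (card (C k))))" for k
      unfolding entropy_def m C(2) by simp
    have "ennreal (\<Sum>k<n. d / 2 ^ (k + 2) * sqrt (ln (card (C k))))
        = (\<Sum>k<n. ennreal (d / 2 ^ (k + 2) * sqrt (ln (card (C k)))))"
      using d ln0 by (intro sum_ennreal[symmetric]) simp
    also have "\<dots> = (\<Sum>k<n. entropy F (?a k) * ennreal (d / 2 ^ (k + 2)))"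
      unfolding e using d ln0 by (intro sum.cong refl) (subst mult.commute, rule ennreal_mult, auto)
    also have "\<dots> \<le> dudley F"
      by (rule dyadic_entropy_sum_le[OF d])
    finally have "ennreal (\<Sum>k<n. d / 2 ^ (k + 2) * sqrt (ln (card (C k)))) \<le> dudley F" .
    then show "(\<Sum>k<n. d / 2 ^ (k + 2) * sqrt (ln (card (C k)))) \<le> enn2real (dudley F)"
      using J d ln0 enn2real_mono[of "ennreal (\<Sum>k<n. d / 2 ^ (k + 2) * sqrt (ln (card (C k))))" "dudley F"]
      by (simp add: sum_nonneg)
  qed
qed

section \<open>Nets for the multipliers and the combined chain\<close>

text \<open>The case \<open>D = 0\<close> is covered by \<open>x / 0 = 0\<close>: the net is then \<open>{0}\<close>.\<close>
lemma interval_net: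
  fixes D \<Lambda> d :: real
  assumes \<Lambda>: "\<Lambda> \<ge> 0" and d: "d > 0"
  obtains G where "finite G" "G \<noteq> {}" "G \<subseteq> {0..\<Lambda>}" "card G \<le> Suc (nat \<lfloor>\<Lambda> * D\<^sup>2 / d\<rfloor>)"
    "\<And>x. x \<in> {0..\<Lambda>} \<Longrightarrow> \<exists>g\<in>G. D\<^sup>2 * \<bar>x - g\<bar> \<le> d"
proof
  \<comment> \<open>Rounding down, rather than to the nearest grid point, keeps the net inside
    \<open>{0..\<Lambda>}\<close>, where multipliers are nonnegative.\<close>
  define r where "r = (\<lambda>x. real (nat \<lfloor>x * D\<^sup>2 / d\<rfloor>) * d / D\<^sup>2)"
  have fl: "real (nat \<lfloor>x * D\<^sup>2 / d\<rfloor>) \<le> x * D\<^sup>2 / d" "x * D\<^sup>2 / d < real (nat \<lfloor>x * D\<^sup>2 / d\<rfloor>) + 1"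
    if "x \<ge> 0" for x
    using that d by (simp_all add: of_nat_nat)
  have r: "0 \<le> r x" "r x \<le> x" "D\<^sup>2 * \<bar>x - r x\<bar> \<le> d" if x: "x \<ge> 0" for x
  proof -
    show "0 \<le> r x" using d by (simp add: r_def)
    show le: "r x \<le> x"
    proof (cases "D = 0")
      case False
      then show ?thesis using fl(1)[OF x] d by (simp add: r_def field_simps)
    qed (use x in \<open>simp add: r_def\<close>)
    show "D\<^sup>2 * \<bar>x - r x\<bar> \<le> d"
    proof (cases "D = 0")
      case False
      then have "D\<^sup>2 * (x - r x) = x * D\<^sup>2 - real (nat \<lfloor>x * D\<^sup>2 / d\<rfloor>) * d"
        by (simp add: r_def field_simps)
      then show ?thesis
        using fl(2)[OF x] d le by (simp add: field_simps)
    qed (use d in simp)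
  qed
  let ?G = "r ` {0..\<Lambda>}"
  have sub: "?G \<subseteq> (\<lambda>n. real n * d / D\<^sup>2) ` {..nat \<lfloor>\<Lambda> * D\<^sup>2 / d\<rfloor>}"
  proof
    fix y assume "y \<in> ?G"
    then obtain x where x: "x \<le> \<Lambda>" "y = r x" by auto
    have "nat \<lfloor>x * D\<^sup>2 / d\<rfloor> \<le> nat \<lfloor>\<Lambda> * D\<^sup>2 / d\<rfloor>"
      using d x(1) by (intro nat_mono floor_mono divide_right_mono mult_right_mono) auto
    then show "y \<in> (\<lambda>n. real n * d / D\<^sup>2) ` {..nat \<lfloor>\<Lambda> * D\<^sup>2 / d\<rfloor>}"
      unfolding x(2) r_def by (intro imageI) simp
  qed
  show fin: "finite ?G"
    by (rule finite_subset[OF sub]) simp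
  show "?G \<noteq> {}" using \<Lambda> by simp
  show "?G \<subseteq> {0..\<Lambda>}"
  proof
    fix y assume "y \<in> ?G"
    then obtain x where x: "0 \<le> x" "x \<le> \<Lambda>" "y = r x" by auto
    then show "y \<in> {0..\<Lambda>}" using r(1,2)[OF x(1)] by simp
  qed
  show "card ?G \<le> Suc (nat \<lfloor>\<Lambda> * D\<^sup>2 / d\<rfloor>)"
    using order_trans[OF card_mono[OF _ sub] card_image_le] by simp
  show "\<exists>g\<in>?G. D\<^sup>2 * \<bar>x - g\<bar> \<le> d" if "x \<in> {0..\<Lambda>}" for x
    using r(3)[of x] that by auto
qed

text \<open>The right-hand side telescopes along dyadic scales.\<close>
lemma grid_entropy_le:
  fixes M d :: real
  assumes M: "M \<ge> 0" and d: "d > 0" and n: "1 \<le> n" "n \<le> Suc (nat \<lfloor>M / d\<rfloor>)"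
  shows "d * sqrt (ln (real n)) \<le> 4 * (sqrt (M * min d M) - sqrt (M * min (d / 2) M))"
proof (cases "d \<le> M")
  \<comment> \<open>At a scale coarser than the whole interval one point suffices. The truncation by
    \<open>min\<close> keeps the right side nonnegative here and later caps the telescoped sum by
    \<open>M\<close>.\<close>
  case False
  then have "nat \<lfloor>M / d\<rfloor> = 0" using M d by (simp add: floor_eq_iff)
  then have "n = 1" using n by simp
  then show ?thesis
    using M d by (simp add: mult_left_mono)
next
  case True
  have "ln (real n) \<le> real n - 1"
    using n(1) by (intro ln_le_minus_one) simp
  also have "\<dots> \<le> real (nat \<lfloor>M / d\<rfloor>)"
    using n(2) by linarith
  also have "\<dots> \<le> M / d"
    using M d by (simp add: of_nat_nat)
  finally have "d * sqrt (ln (real n)) \<le> d * sqrt (M / d)"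
    using d by simp
  also have "\<dots> = sqrt (M * d)"
    using d M by (simp add: real_sqrt_mult real_sqrt_divide field_simps)
  finally have 1: "d * sqrt (ln (real n)) \<le> sqrt (M * d)" .
  \<comment> \<open>Since \<open>1 / 2 \<le> (3 / 4)\<^sup>2\<close>, halving the scale lowers the
    root by at least a quarter of its value; this is the origin of the factor 4.\<close>
  have "sqrt (M * (d / 2)) \<le> sqrt (M * d * (3 / 4)\<^sup>2)"
    using M d by (intro real_sqrt_le_mono) (simp add: power2_eq_square)
  also have "\<dots> = sqrt (M * d) * (3 / 4)"
    by (simp only: real_sqrt_mult real_sqrt_abs abs_of_nonneg)
  finally have "sqrt (M * (d / 2)) \<le> sqrt (M * d) * (3 / 4)" .
  then show ?thesis
    using 1 True d by (simp add: min_def)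
qed

text \<open>Each increment of the process is sub-Gaussian already without symmetrization, so plain dyadic
  chaining over the pairs (multiplier, loss) suffices.\<close>
lemma expected_sup_net:
  fixes P :: "'z::polish_space measure" and F :: "('z \<Rightarrow> real) set"
  defines "D \<equiv> diameter (UNIV :: 'z set)"
  assumes bounded: "bounded (UNIV :: 'z set)"
    and P: "prob_space P" "sets P = sets borel" and N: "N \<ge> 1"
    and F: "\<And>l z. l \<in> F \<Longrightarrow> 0 \<le> l z \<and> l z \<le> B" and ne: "F \<noteq> {}"
    and J: "dudley F < \<infinity>" and \<Lambda>: "\<Lambda> \<ge> 0" and e: "e > 0"
  obtains T where "finite T" "T \<noteq> {}" "T \<subseteq> {0..\<Lambda>} \<times> F"
    "\<And>\<kappa> l. \<kappa> \<in> {0..\<Lambda>} \<Longrightarrow> l \<in> F \<Longrightarrow>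
       \<exists>(\<mu>, m)\<in>T. \<forall>z. \<bar>c_transform \<kappa> l z - c_transform \<mu> m z\<bar> \<le> e"
    "(\<integral>w. Max ((\<lambda>(\<kappa>, l). dev P N (c_transform \<kappa> l) w) ` T) \<partial>PiM {..<N} (\<lambda>_. P))
       \<le> (12 * enn2real (dudley F) + 24 * (\<Lambda> * D\<^sup>2)) / sqrt N"
proof -
  let ?M = "PiM {..<N} (\<lambda>_. P)"
  interpret M: prob_space ?M by (rule prob_space_PiM) (rule P)
  obtain f0 where f0: "f0 \<in> F" using ne by blast
  have B0: "B \<ge> 0" using F[OF f0] by (meson order_trans)
  define M where "M = \<Lambda> * D\<^sup>2"
  have M0: "M \<ge> 0" using \<Lambda> by (simp add: M_def)
  \<comment> \<open>Large enough for one index to cover everything in both coordinates; the added 1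
    makes the scale positive.\<close>
  define d0 where "d0 = max B M + 1"
  have d0: "d0 > 0" "B \<le> d0" "M \<le> d0" using B0 by (auto simp: d0_def)
  define d where "d = (\<lambda>k::nat. d0 / 2 ^ k)"
  have d_pos: "d k > 0" and d_Suc: "d (Suc k) = d k / 2" for k
    using d0 by (simp_all add: d_def)
  have dist_D: "dist x y \<le> D" for x y :: 'z
    unfolding D_def using diameter_bounded_bound[OF bounded] by blast
  define U where "U = {0..\<Lambda>} \<times> F"
  define \<phi> where "\<phi> = (\<lambda>t::real \<times> ('z \<Rightarrow> real). c_transform (fst t) (snd t))"
  have \<phi>_meas: "\<phi> t \<in> borel_measurable borel" and \<phi>_abs: "\<bar>\<phi> t z\<bar> \<le> B" if t: "t \<in> U" for t z
  proof -
    have k: "fst t \<ge> 0" and l: "\<And>x. snd t x \<le> B" "\<And>x. 0 \<le> snd t x"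
      using t F by (auto simp: U_def)
    show "\<phi> t \<in> borel_measurable borel"
      unfolding \<phi>_def by (rule borel_measurable_c_transform[OF k l(1)])
    show "\<bar>\<phi> t z\<bar> \<le> B"
      using c_transform_le[of "fst t" "snd t" B z, OF k l(1)] c_transform_ge[of "fst t" "snd t" B z, OF k l(1)]
        l(2)[of z] unfolding \<phi>_def by linarith
  qed
  have close: "\<bar>\<phi> (\<kappa>, l) z - \<phi> (\<mu>, m) z\<bar> \<le> 2 * a"
    if "(\<kappa>, l) \<in> U" "(\<mu>, m) \<in> U" "\<And>z. \<bar>l z - m z\<bar> \<le> a" "D\<^sup>2 * \<bar>\<kappa> - \<mu>\<bar> \<le> a" for \<kappa> l \<mu> m a z
  proof -
    have "\<bar>c_transform \<kappa> l z - c_transform \<mu> m z\<bar> \<le> a + a"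
      by (rule c_transform_perturb[where B=B and D=D]) (use that F dist_D in \<open>auto simp: U_def\<close>)
    then show ?thesis by (simp add: \<phi>_def)
  qed
  obtain C where C: "\<And>k. finite (C k)" "\<And>k. C k \<subseteq> F"
    "\<And>k l. l \<in> F \<Longrightarrow> \<exists>c\<in>C k. \<forall>z. \<bar>l z - c z\<bar> \<le> d0 / 2 ^ Suc k"
    "\<And>n. (\<Sum>k<n. d0 / 2 ^ (k + 2) * sqrt (ln (card (C k)))) \<le> enn2real (dudley F)"
    by (rule dyadic_covers[of F B d0]) (use F d0 J in blast)+
  have "\<exists>G. finite G \<and> G \<noteq> {} \<and> G \<subseteq> {0..\<Lambda>} \<and> card G \<le> Suc (nat \<lfloor>M / d (Suc k)\<rfloor>)
      \<and> (\<forall>x\<in>{0..\<Lambda>}. \<exists>g\<in>G. D\<^sup>2 * \<bar>x - g\<bar> \<le> d (Suc k))" for k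
    using interval_net[OF \<Lambda> d_pos[of "Suc k"], of D] unfolding M_def by metis
  then obtain G where G: "\<And>k. finite (G k)" "\<And>k. G k \<noteq> {}" "\<And>k. G k \<subseteq> {0..\<Lambda>}"
    "\<And>k. card (G k) \<le> Suc (nat \<lfloor>M / d (Suc k)\<rfloor>)"
    "\<And>k x. x \<in> {0..\<Lambda>} \<Longrightarrow> \<exists>g\<in>G k. D\<^sup>2 * \<bar>x - g\<bar> \<le> d (Suc k)"
    by metis
  have C_ne: "C k \<noteq> {}" for k using C(3)[OF f0] by blast
  \<comment> \<open>Level 0 is a single index, whose deviation has mean zero, so the chain starts at
    no cost. The covers are numbered one lower: \<open>G j\<close> and \<open>C j\<close> have
    radius \<open>d (Suc j)\<close>, which makes every level \<open>k\<close> a net of radius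
    \<open>2 * d k\<close>.\<close>
  define T where "T = (\<lambda>k. case k of 0 \<Rightarrow> {(0, f0)} | Suc j \<Rightarrow> G j \<times> C j)"
  have T_fin: "finite (T k)" and T_ne: "T k \<noteq> {}" for k
    using C(1) G(1,2) C_ne by (simp_all add: T_def split: nat.split)
  have T_U: "T k \<subseteq> U" for k
  proof (cases k)
    case 0
    then show ?thesis using f0 \<Lambda> by (simp add: T_def U_def)
  next
    case (Suc j)
    then show ?thesis
      using Sigma_mono[OF G(3)[of j] C(2)[of j]] by (simp add: T_def U_def)
  qed
  have T_close: "\<exists>s\<in>T k. \<forall>z. \<bar>\<phi> t z - \<phi> s z\<bar> \<le> 2 * d k" if t: "t \<in> U" for t k
  proof -
    obtain \<kappa> l where tt: "t = (\<kappa>, l)" "\<kappa> \<in> {0..\<Lambda>}" "l \<in> F"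
      using t by (auto simp: U_def)
    show ?thesis
    proof (cases k)
      case 0
      have "\<bar>\<phi> (\<kappa>, l) z - \<phi> (0, f0) z\<bar> \<le> 2 * d 0" for z
      proof (rule close)
        show "\<bar>l z - f0 z\<bar> \<le> d 0" for z
          using F[OF tt(3), of z] F[OF f0, of z] d0 by (simp add: d_def abs_le_iff)
        have "D\<^sup>2 * \<kappa> \<le> D\<^sup>2 * \<Lambda>"
          using tt(2) by (intro mult_left_mono) auto
        then show "D\<^sup>2 * \<bar>\<kappa> - 0\<bar> \<le> d 0"
          using tt(2) d0 by (simp add: d_def M_def mult.commute)
      qed (use tt f0 \<Lambda> in \<open>auto simp: U_def\<close>)
      then show ?thesis using 0 tt by (simp add: T_def)
    next
      case (Suc j)
      obtain c where c: "c \<in> C j" "\<And>z. \<bar>l z - c z\<bar> \<le> d (Suc j)"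
        using C(3)[OF tt(3), of j] unfolding d_def by blast
      obtain g where g: "g \<in> G j" "D\<^sup>2 * \<bar>\<kappa> - g\<bar> \<le> d (Suc j)"
        using G(5)[OF tt(2)] by blast
      have "(g, c) \<in> T k" using c g Suc by (simp add: T_def)
      moreover have "\<bar>\<phi> (\<kappa>, l) z - \<phi> (g, c) z\<bar> \<le> 2 * d k" for z
        unfolding Suc by (rule close) (use t tt c g T_U[of k] \<open>(g, c) \<in> T k\<close> in auto)
      ultimately show ?thesis using tt by blast
    qed
  qed
  have "\<exists>\<pi>. \<forall>k. \<forall>t\<in>U. \<pi> k t \<in> T k \<and> (\<forall>z. \<bar>\<phi> t z - \<phi> (\<pi> k t) z\<bar> \<le> 2 * d k)"
    by (intro choice allI bchoice ballI) (use T_close in blast)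
  then obtain \<pi> where \<pi>: "\<And>k t. t \<in> U \<Longrightarrow> \<pi> k t \<in> T k"
    "\<And>k t z. t \<in> U \<Longrightarrow> \<bar>\<phi> t z - \<phi> (\<pi> k t) z\<bar> \<le> 2 * d k"
    by blast
  define X where "X = (\<lambda>t. dev P N (\<phi> t))"
  \<comment> \<open>A link from level \<open>Suc k\<close> has length at most
    \<open>2 * d k\<close>, the radius of the coarser level.\<close>
  define \<sigma> where "\<sigma> = (\<lambda>k. 2 * d k / sqrt N)"
  have chain: "(\<integral>w. Max ((\<lambda>t. X t w) ` T n) \<partial>?M)
      \<le> (\<integral>w. Max ((\<lambda>t. X t w) ` T 0) \<partial>?M) + (\<Sum>k<n. \<sigma> k * sqrt (2 * ln (card (T (Suc k)))))" for n
  proof (rule M.expectation_Max_chain[where U=U and K="2 * B" and \<pi>=\<pi>])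
    fix k t and s :: real assume t: "t \<in> T (Suc k)" and s: "s > 0"
    have tU: "t \<in> U" "\<pi> k t \<in> U" using t \<pi>(1) T_U by blast+
    have "X t w - X (\<pi> k t) w = dev P N (\<lambda>z. \<phi> t z - \<phi> (\<pi> k t) z) w" for w
      unfolding X_def by (rule dev_diff[OF P N \<phi>_meas \<phi>_abs \<phi>_meas \<phi>_abs, symmetric]) (use tU in auto)
    then show "M.expectation (\<lambda>w. exp (s * (X t w - X (\<pi> k t) w))) \<le> exp (s\<^sup>2 * (\<sigma> k)\<^sup>2 / 2)"
      unfolding \<sigma>_def using dev_mgf[OF P N _ \<pi>(2)[OF tU(1)] s] \<phi>_meas[OF tU(1)] \<phi>_meas[OF tU(2)] by simp
  next
    show "X t \<in> borel_measurable ?M" if "t \<in> U" for t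
      unfolding X_def by (rule measurable_dev[OF P N \<phi>_meas[OF that]])
    show "\<bar>X t w\<bar> \<le> 2 * B" if "t \<in> U" for t w
      unfolding X_def by (rule dev_bound[OF P N \<phi>_meas[OF that] \<phi>_abs[OF that]])
    show "\<pi> k t \<in> T k" if "t \<in> T (Suc k)" for k t
      using that \<pi>(1) T_U by blast
    show "0 \<le> \<sigma> k" for k
      using d_pos[of k] by (simp add: \<sigma>_def)
  qed (rule T_fin T_ne T_U)+
  have base: "(\<integral>w. Max ((\<lambda>t. X t w) ` T 0) \<partial>?M) = 0"
  proof -
    have U0: "(0, f0) \<in> U" using f0 \<Lambda> by (simp add: U_def)
    show ?thesis
      using expectation_dev[OF P N \<phi>_meas[OF U0] \<phi>_abs[OF U0]] by (simp add: T_def X_def)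
  qed
  define V where "V = (\<lambda>k. sqrt (M * min (d (Suc k)) M))"
  have level: "\<sigma> k * sqrt (2 * ln (card (T (Suc k))))
      \<le> (24 * (V k - V (Suc k)) + 12 * (d0 / 2 ^ (k + 2) * sqrt (ln (card (C k))))) / sqrt N" for k
  proof -
    let ?g = "real (card (G k))" and ?c = "real (card (C k))"
    have g1: "card (G k) \<ge> 1" and c1: "card (C k) \<ge> 1"
      using G(1,2) C(1) C_ne by (simp_all add: Suc_leI card_gt_0_iff)
    have g0: "0 \<le> ln ?g" and c0: "0 \<le> ln ?c" using g1 c1 by simp_all
    have "ln (card (T (Suc k))) = ln ?g + ln ?c"
      using g1 c1 by (simp add: T_def card_cartesian_product ln_mult)
    then have "sqrt (2 * ln (card (T (Suc k)))) = sqrt 2 * sqrt (ln ?g + ln ?c)"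
      by (simp only: real_sqrt_mult)
    also have "\<dots> \<le> 3 / 2 * (sqrt (ln ?g) + sqrt (ln ?c))"
    proof (rule mult_mono)
      show "sqrt 2 \<le> 3 / 2" by (rule real_le_lsqrt) (simp_all add: power2_eq_square)
      show "sqrt (ln ?g + ln ?c) \<le> sqrt (ln ?g) + sqrt (ln ?c)"
        by (rule sqrt_add_le_add_sqrt[OF g0 c0])
    qed (use g0 c0 in auto)
    finally have "2 * d k * sqrt (2 * ln (card (T (Suc k)))) \<le> 2 * d k * (3 / 2 * (sqrt (ln ?g) + sqrt (ln ?c)))"
      using d_pos[of k] by (intro mult_left_mono) auto
    \<comment> \<open>With \<open>sqrt 2\<close> rounded up to 3/2 the factor is
      \<open>3 * d k\<close>. This is \<open>6 * d (Suc k)\<close>, and it is also 12 times the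
      length \<open>d0 / 2 ^ (k + 2)\<close> of the interval charged for \<open>C k\<close>. The
      factor 4 of the grid estimate turns 6 into 24.\<close>
    also have "\<dots> = 6 * (d (Suc k) * sqrt (ln ?g)) + 12 * (d0 / 2 ^ (k + 2) * sqrt (ln ?c))"
      by (simp add: d_def field_simps)
    also have "d (Suc k) * sqrt (ln ?g) \<le> 4 * (V k - V (Suc k))"
      using grid_entropy_le[OF M0 d_pos g1 G(4)] by (simp add: V_def d_Suc)
    finally have "2 * d k * sqrt (2 * ln (card (T (Suc k))))
        \<le> 24 * (V k - V (Suc k)) + 12 * (d0 / 2 ^ (k + 2) * sqrt (ln ?c))"
      by simp
    then have "2 * d k * sqrt (2 * ln (card (T (Suc k)))) / sqrt N
        \<le> (24 * (V k - V (Suc k)) + 12 * (d0 / 2 ^ (k + 2) * sqrt (ln ?c))) / sqrt N"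
      by (rule divide_right_mono) simp
    then show ?thesis by (simp add: \<sigma>_def)
  qed
  have total: "(\<integral>w. Max ((\<lambda>t. X t w) ` T n) \<partial>?M) \<le> (12 * enn2real (dudley F) + 24 * M) / sqrt N" for n
  proof -
    have V: "V 0 - V n \<le> M"
    proof -
      have "V 0 \<le> sqrt (M * M)"
        unfolding V_def using M0 by (intro real_sqrt_le_mono mult_left_mono) auto
      moreover have "V n \<ge> 0"
        unfolding V_def using M0 d_pos[of "Suc n"] by simp
      ultimately show ?thesis using M0 by simp
    qed
    have "(\<integral>w. Max ((\<lambda>t. X t w) ` T n) \<partial>?M) \<le> (\<Sum>k<n. \<sigma> k * sqrt (2 * ln (card (T (Suc k)))))"
      using chain[of n] base by simp
    also have "\<dots> \<le> (\<Sum>k<n. (24 * (V k - V (Suc k)) + 12 * (d0 / 2 ^ (k + 2) * sqrt (ln (card (C k))))) / sqrt N)"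
      by (intro sum_mono level)
    also have "\<dots> = (24 * (\<Sum>k<n. V k - V (Suc k)) + 12 * (\<Sum>k<n. d0 / 2 ^ (k + 2) * sqrt (ln (card (C k))))) / sqrt N"
      by (simp only: sum.distrib sum_distrib_left sum_divide_distrib[symmetric])
    also have "\<dots> \<le> (24 * M + 12 * enn2real (dudley F)) / sqrt N"
      using C(4)[of n] V by (intro divide_right_mono add_mono mult_left_mono) (simp_all add: sum_lessThan_telescope')
    finally show ?thesis by (simp add: add.commute)
  qed
  \<comment> \<open>The bound \<open>total\<close> is the same at every depth, so any precision of
    the net is free and the depth can be chosen last.\<close>
  obtain n where "2 * d0 / e < 2 ^ n"
    using real_arch_pow[of 2 "2 * d0 / e"] by auto
  then have n: "2 * d n \<le> e"
    using e by (simp add: d_def field_simps)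
  show thesis
  proof (rule that[OF T_fin T_ne])
    show "T n \<subseteq> {0..\<Lambda>} \<times> F" using T_U by (simp add: U_def)
    show "\<exists>(\<mu>, m)\<in>T n. \<forall>z. \<bar>c_transform \<kappa> l z - c_transform \<mu> m z\<bar> \<le> e"
      if "\<kappa> \<in> {0..\<Lambda>}" "l \<in> F" for \<kappa> l
    proof -
      have "(\<kappa>, l) \<in> U" using that by (simp add: U_def)
      then obtain \<mu> m where s: "(\<mu>, m) \<in> T n" "\<And>z. \<bar>\<phi> (\<kappa>, l) z - \<phi> (\<mu>, m) z\<bar> \<le> 2 * d n"
        using T_close by (metis surj_pair)
      have "\<bar>c_transform \<kappa> l z - c_transform \<mu> m z\<bar> \<le> e" for z
        using s(2)[of z] n by (simp add: \<phi>_def)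
      then show ?thesis
        using s(1) by blast
    qed
    show "(\<integral>w. Max ((\<lambda>(\<kappa>, l). dev P N (c_transform \<kappa> l) w) ` T n) \<partial>?M)
       \<le> (12 * enn2real (dudley F) + 24 * (\<Lambda> * D\<^sup>2)) / sqrt N"
      using total[of n] unfolding X_def \<phi>_def M_def by (simp add: case_prod_beta')
  qed
qed

section \<open>The excess risk bound\<close>

lemma abs_Max_diff_le:
  fixes f g :: "'t \<Rightarrow> real"
  assumes T: "finite T" "T \<noteq> {}" and fg: "\<And>t. t \<in> T \<Longrightarrow> \<bar>f t - g t\<bar> \<le> c"
  shows "\<bar>Max (f ` T) - Max (g ` T)\<bar> \<le> c"
proof -
  have *: "Max (f ` T) \<le> Max (g ` T) + c" if fg: "\<And>t. t \<in> T \<Longrightarrow> \<bar>f t - g t\<bar> \<le> c" for f g :: "'t \<Rightarrow> real"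
  proof -
    have "f t \<le> Max (g ` T) + c" if t: "t \<in> T" for t
    proof -
      have "g t \<le> Max (g ` T)" using T t by (intro Max_ge) auto
      then show ?thesis using fg[OF t] by linarith
    qed
    then show ?thesis using T by (subst Max_le_iff) auto
  qed
  have "Max (f ` T) \<le> Max (g ` T) + c"
    by (rule *[OF fg])
  moreover have "Max (g ` T) \<le> Max (f ` T) + c"
    using fg by (intro *) (simp add: abs_minus_commute)
  ultimately show ?thesis by linarith
qed

theorem theorem4:
  fixes P :: "'z::polish_space measure"
    and F :: "('z \<Rightarrow> real) set"
    and B L \<alpha> \<eta> :: real and N :: nat
    and lhat :: "(nat \<Rightarrow> 'z) \<Rightarrow> 'z \<Rightarrow> real"
  assumes bounded_Z: "bounded (UNIV :: 'z set)"
    and P: "prob_space P" "sets P = sets borel"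
    and B: "\<forall>l\<in>F. \<forall>z. 0 \<le> l z \<and> l z \<le> B"
    and usc: "\<forall>l\<in>F. usc l"
    and Lip: "\<forall>l\<in>F. \<forall>z z'. l z' - l z \<le> L * dist z z'"
    and J: "dudley F < \<infinity>"
    and alpha: "\<alpha> > 0"
    and N: "N \<ge> 1"
    and lhat: "\<forall>\<omega>\<in>space (PiM {..<N} (\<lambda>_. P)). lhat \<omega> \<in> F \<and>
                 (\<forall>l\<in>F. WRisk (empirical N \<omega>) \<alpha> (lhat \<omega>) \<le> WRisk (empirical N \<omega>) \<alpha> l)"
    and attained: "\<exists>ls\<in>F. WRisk P \<alpha> ls = (INF l\<in>F. WRisk P \<alpha> l)"
    and eta: "0 < \<eta>" "\<eta> < 1"
  shows "\<exists>A \<in> sets (PiM {..<N} (\<lambda>_. P)).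
           A \<subseteq> {\<omega> \<in> space (PiM {..<N} (\<lambda>_. P)).
                 WRisk P \<alpha> (lhat \<omega>) - (INF l\<in>F. WRisk P \<alpha> l)
                   \<le> 48 * enn2real (dudley F) / sqrt N
                     + 48 * L * (diameter (UNIV :: 'z set))\<^sup>2 / (\<alpha> * sqrt N)
                     + 3 * B * sqrt (ln (2 / \<eta>) / (2 * N))}
         \<and> measure (PiM {..<N} (\<lambda>_. P)) A \<ge> 1 - \<eta>"
proof -
  let ?M = "PiM {..<N} (\<lambda>_. P)" and ?D = "diameter (UNIV :: 'z set)"
  interpret M: prob_space ?M by (rule prob_space_PiM) (rule P)
  \<comment> \<open>On a one-point space a negative \<open>L\<close> is a Lipschitz constant too,
    while duality asks for a nonnegative one. Replacing it by its positive part leaves the bound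
    unchanged, since the diameter is then zero.\<close>
  define L' where "L' = max L 0"
  define \<Lambda> where "\<Lambda> = L' / \<alpha>"
  \<comment> \<open>The level at which McDiarmid's inequality with differences \<open>B / N\<close>
    fails with probability \<open>\<eta> / 2\<close>; two such failures are discarded.\<close>
  define t where "t = B * sqrt (ln (2 / \<eta>) / (2 * N))"
  define J' where "J' = enn2real (dudley F)"
  have L'0: "L' \<ge> 0" by (simp add: L'_def)
  have \<Lambda>0: "\<Lambda> \<ge> 0" using L'0 alpha by (simp add: \<Lambda>_def)
  have J'0: "J' \<ge> 0" by (simp add: J'_def)
  obtain ls where ls: "ls \<in> F" "WRisk P \<alpha> ls = (INF l\<in>F. WRisk P \<alpha> l)"
    using attained by blast
  have Bnn: "B \<ge> 0" using B ls(1) by (meson order_trans)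
  have LD: "L' * ?D\<^sup>2 = L * ?D\<^sup>2"
  proof (cases "L \<ge> 0")
    case False
    have "dist x y = 0" for x y :: 'z
    proof -
      have "0 \<le> L * dist x y"
        using Lip ls(1) dist_commute[of x y] by (smt (verit))
      then show ?thesis
        using False by (simp add: zero_le_mult_iff)
    qed
    then have "(UNIV :: 'z set) = {undefined}" by auto
    then have "?D = 0" by (metis diameter_singleton)
    then show ?thesis by simp
  qed (simp add: L'_def)
  have loss: "lipschitz_loss l B L'" if l: "l \<in> F" for l
  proof
    show "l z' - l z \<le> L' * dist z z'" for z z'
    proof -
      have "L * dist z z' \<le> L' * dist z z'"
        by (intro mult_right_mono) (auto simp: L'_def)
      then show ?thesis using Lip l by (meson order_trans)
    qed
  qed (use bounded_Z B l L'0 in auto)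
  have goal_eq: "48 * enn2real (dudley F) / sqrt N + 48 * L * ?D\<^sup>2 / (\<alpha> * sqrt N) + 3 * B * sqrt (ln (2 / \<eta>) / (2 * N))
      = (48 * J' + 48 * (\<Lambda> * ?D\<^sup>2)) / sqrt N + 3 * t"
    using LD alpha N by (auto simp: J'_def \<Lambda>_def t_def field_simps)
  show ?thesis
  \<comment> \<open>McDiarmid's inequality is used with positive differences and t > 0. If the range
    degenerates, all losses coincide and the excess is zero.\<close>
  proof (cases "B = 0")
    case True
    have "l = (\<lambda>_. 0)" if "l \<in> F" for l
    proof
      fix z
      have "0 \<le> l z" "l z \<le> 0" using B that True by auto
      then show "l z = 0" by simp
    qed
    then have "lhat w = ls" if "w \<in> space ?M" for w
      using lhat that ls(1) by metis
    then have "WRisk P \<alpha> (lhat w) - (INF l\<in>F. WRisk P \<alpha> l)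
        \<le> (48 * J' + 48 * (\<Lambda> * ?D\<^sup>2)) / sqrt N + 3 * t" if "w \<in> space ?M" for w
      using that ls(2) J'0 \<Lambda>0 True by (simp add: t_def)
    then show ?thesis
      unfolding goal_eq using eta M.prob_space by (intro bexI[of _ "space ?M"]) auto
  next
    case False
    then have B0: "B > 0" using Bnn by simp
    have "ln (2 / \<eta>) > 0" using eta by simp
    then have t0: "t > 0" using B0 N by (simp add: t_def)
    have tail: "exp (- 2 * t\<^sup>2 / (real N * (B / real N)\<^sup>2)) = \<eta> / 2"
    proof -
      have "t\<^sup>2 = B\<^sup>2 * (ln (2 / \<eta>) / (2 * N))"
        unfolding t_def power_mult_distrib using \<open>ln (2 / \<eta>) > 0\<close> by simp
      then have "- 2 * t\<^sup>2 / (real N * (B / real N)\<^sup>2) = - ln (2 / \<eta>)"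
        using B0 N by (simp add: field_simps power2_eq_square)
      then show ?thesis using eta by (simp add: exp_minus)
    qed
    define \<phi> where "\<phi> = (\<lambda>p::real \<times> ('z \<Rightarrow> real). c_transform (fst p) (snd p))"
    have \<phi>: "\<phi> p \<in> borel_measurable borel" "\<And>z. 0 \<le> \<phi> p z" "\<And>z. \<phi> p z \<le> B"
      if p: "fst p \<ge> 0" "snd p \<in> F" for p
    proof -
      have l: "\<And>x. snd p x \<le> B" "\<And>x. 0 \<le> snd p x" using B p(2) by auto
      show "\<phi> p \<in> borel_measurable borel"
        unfolding \<phi>_def by (rule borel_measurable_c_transform[OF p(1) l(1)])
      show "0 \<le> \<phi> p z" "\<phi> p z \<le> B" for z
        using c_transform_le[of "fst p" "snd p" B z, OF p(1) l(1)]
          c_transform_ge[of "fst p" "snd p" B z, OF p(1) l(1)] l(2)[of z]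
        unfolding \<phi>_def by linarith+
    qed
    \<comment> \<open>The two-sided range makes the oscillation B rather than 2 * B, which the size
      of \<open>t\<close> relies on.\<close>
    have \<phi>_abs: "\<bar>\<phi> p z\<bar> \<le> B" and \<phi>_osc: "\<bar>\<phi> p z - \<phi> p z'\<bar> \<le> B"
      if p: "fst p \<ge> 0" "snd p \<in> F" for p z z'
      using \<phi>(2,3)[OF p, of z] \<phi>(2,3)[OF p, of z'] by linarith+
    define X where "X = (\<lambda>p. dev P N (\<phi> p))"
    have X_meas: "X p \<in> borel_measurable ?M" and X_bound: "\<bar>X p w\<bar> \<le> 2 * B"
      if p: "fst p \<ge> 0" "snd p \<in> F" for p w
      unfolding X_def using measurable_dev[OF P N \<phi>(1)[OF p]] dev_bound[OF P N \<phi>(1)[OF p] \<phi>_abs[OF p]]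
      by blast+
    have X_upd: "\<bar>X p (w(i := x)) - X p w\<bar> \<le> B / real N"
      if p: "fst p \<ge> 0" "snd p \<in> F" and i: "i < N" for p w i x
      unfolding X_def by (rule dev_update[OF P N \<phi>_osc[OF p] i])
    \<comment> \<open>Radius \<open>t / 2\<close>, because a deviation is at most twice the uniform
      norm: moving an index to the net then costs at most \<open>t\<close>.\<close>
    obtain T where T: "finite T" "T \<noteq> {}" "T \<subseteq> {0..\<Lambda>} \<times> F"
      and net: "\<And>\<kappa> l. \<kappa> \<in> {0..\<Lambda>} \<Longrightarrow> l \<in> F \<Longrightarrow>
         \<exists>(\<mu>, m)\<in>T. \<forall>z. \<bar>c_transform \<kappa> l z - c_transform \<mu> m z\<bar> \<le> t / 2"
      and ET: "(\<integral>w. Max ((\<lambda>(\<kappa>, l). dev P N (c_transform \<kappa> l) w) ` T) \<partial>?M)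
         \<le> (12 * enn2real (dudley F) + 24 * (\<Lambda> * ?D\<^sup>2)) / sqrt N"
    proof (rule expected_sup_net[OF bounded_Z P N _ _ J \<Lambda>0])
      show "0 < t / 2" using t0 by simp
      show "F \<noteq> {}" using ls(1) by blast
      show "0 \<le> l z \<and> l z \<le> B" if "l \<in> F" for l z using B that by blast
    qed blast
    define S where "S = (\<lambda>w. Max ((\<lambda>p. X p w) ` T))"
    have TF: "fst p \<ge> 0" "snd p \<in> F" if "p \<in> T" for p
      using T(3) that by auto
    define m where "m = (\<integral>w. S w \<partial>?M)"
    have m: "m \<le> (12 * J' + 24 * (\<Lambda> * ?D\<^sup>2)) / sqrt N"
      using ET by (simp add: m_def S_def X_def \<phi>_def J'_def case_prod_beta')
    define bad1 where "bad1 = {w \<in> space ?M. S w - m \<ge> t}"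
    have S_meas [measurable]: "S \<in> borel_measurable ?M"
      unfolding S_def using X_meas TF by (intro borel_measurable_Max T) auto
    have bad1: "measure ?M bad1 \<le> \<eta> / 2"
      unfolding bad1_def m_def tail[symmetric]
    proof (rule McDiarmid_inequality[OF P(1) S_meas, where K="2 * B"])
      fix w i x assume "i < N"
      show "\<bar>S (w(i := x)) - S w\<bar> \<le> B / real N"
        unfolding S_def by (rule abs_Max_diff_le[OF T(1,2)]) (use X_upd TF \<open>i < N\<close> in blast)
    next
      fix w
      have "S w \<in> (\<lambda>p. X p w) ` T"
        unfolding S_def using T by (intro Max_in) auto
      then obtain p where "p \<in> T" "S w = X p w" by blast
      then show "\<bar>S w\<bar> \<le> 2 * B"
        using X_bound[OF TF] by simp
    qed (use B0 N t0 in auto)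
    \<comment> \<open>This multiplier depends only on \<open>P\<close>, so its index is fixed in
      advance and the lower tail of one mean-zero variable suffices.\<close>
    obtain \<kappa>s where \<kappa>s: "0 \<le> \<kappa>s" "\<kappa>s \<le> \<Lambda>"
      "\<kappa>s * \<alpha>\<^sup>2 + (\<integral>z. c_transform \<kappa>s ls z \<partial>P) \<le> WRisk P \<alpha> ls"
      using lipschitz_loss.strong_duality[OF loss[OF ls(1)] P alpha] unfolding \<Lambda>_def by blast
    define ps where "ps = (\<kappa>s, ls)"
    have ps: "fst ps \<ge> 0" "snd ps \<in> F" using \<kappa>s ls by (simp_all add: ps_def)
    define bad2 where "bad2 = {w \<in> space ?M. - X ps w \<ge> t}"
    have Xs_meas [measurable]: "(\<lambda>w. - X ps w) \<in> borel_measurable ?M"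
      using X_meas[OF ps] by simp
    have "(\<integral>w. - X ps w \<partial>?M) = 0"
      using expectation_dev[OF P N \<phi>(1)[OF ps] \<phi>_abs[OF ps]] by (simp add: X_def)
    then have bad2_eq: "bad2 = {w \<in> space ?M. - X ps w - (\<integral>w. - X ps w \<partial>?M) \<ge> t}"
      by (simp add: bad2_def)
    have bad2: "measure ?M bad2 \<le> \<eta> / 2"
      unfolding bad2_eq tail[symmetric]
    proof (rule McDiarmid_inequality[OF P(1) Xs_meas, where K="2 * B"])
      show "\<bar>- X ps (w(i := x)) - - X ps w\<bar> \<le> B / real N" if "i < N" for w i x
        using X_upd[OF ps that, of w x] by linarith
      show "\<bar>- X ps w\<bar> \<le> 2 * B" for w
        using X_bound[OF ps, of w] by simp
    qed (use B0 N t0 in auto)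
    have [measurable]: "bad1 \<in> sets ?M" "bad2 \<in> sets ?M"
      unfolding bad1_def bad2_def by measurable
    let ?A = "space ?M - (bad1 \<union> bad2)"
    have "measure ?M (bad1 \<union> bad2) \<le> \<eta>"
      using measure_Un_le[of bad1 ?M bad2] bad1 bad2 by simp
    then have prob: "measure ?M ?A \<ge> 1 - \<eta>"
      by (subst M.prob_compl) auto
    have excess: "WRisk P \<alpha> (lhat w) - (INF l\<in>F. WRisk P \<alpha> l) \<le> (48 * J' + 48 * (\<Lambda> * ?D\<^sup>2)) / sqrt N + 3 * t"
      if w: "w \<in> ?A" for w
    proof -
      let ?E = "empirical N w"
      have w1: "S w - m < t" "- X ps w < t"
        using w by (auto simp: bad1_def bad2_def)
      have lw: "lhat w \<in> F" "WRisk ?E \<alpha> (lhat w) \<le> WRisk ?E \<alpha> ls"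
        using lhat w ls(1) by auto
      have E: "prob_space ?E" "sets ?E = sets borel"
        using empirical_properties(1,2)[OF N] by blast+
      have dev_eq: "(\<integral>z. \<phi> p z \<partial>P) - (\<integral>z. \<phi> p z \<partial>?E) = X p w" if "fst p \<ge> 0" "snd p \<in> F" for p
        unfolding X_def dev_def empirical_properties(3)[OF N \<phi>(1)[OF that]] by simp
      \<comment> \<open>This multiplier and the loss both vary with the sample, so their index is
        controlled only through the maximum over the net.\<close>
      obtain \<kappa> where \<kappa>: "0 \<le> \<kappa>" "\<kappa> \<le> \<Lambda>"
        "\<kappa> * \<alpha>\<^sup>2 + (\<integral>z. c_transform \<kappa> (lhat w) z \<partial>?E) \<le> WRisk ?E \<alpha> (lhat w)"
        using lipschitz_loss.strong_duality[OF loss[OF lw(1)] E alpha] unfolding \<Lambda>_def by blast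
      let ?p = "(\<kappa>, lhat w)"
      have p: "fst ?p \<ge> 0" "snd ?p \<in> F" using \<kappa> lw by simp_all
      have up: "WRisk P \<alpha> (lhat w) - WRisk ?E \<alpha> (lhat w) \<le> X ?p w"
        using lipschitz_loss.weak_duality[OF loss[OF lw(1)] P \<kappa>(1) alpha] \<kappa>(3) dev_eq[OF p]
        by (simp add: \<phi>_def)
      have down: "WRisk ?E \<alpha> ls - WRisk P \<alpha> ls \<le> - X ps w"
        using lipschitz_loss.weak_duality[OF loss[OF ls(1)] E \<kappa>s(1) alpha] \<kappa>s(3) dev_eq[OF ps]
        by (simp add: \<phi>_def ps_def)
      obtain \<mu> f where q: "(\<mu>, f) \<in> T" "\<And>z. \<bar>\<phi> ?p z - \<phi> (\<mu>, f) z\<bar> \<le> t / 2"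
        using net[of \<kappa> "lhat w"] \<kappa> lw(1) unfolding \<phi>_def by auto
      note qT = TF[OF q(1)]
      have "X ?p w - X (\<mu>, f) w = dev P N (\<lambda>z. \<phi> ?p z - \<phi> (\<mu>, f) z) w"
        unfolding X_def by (rule dev_diff[OF P N \<phi>(1)[OF p] \<phi>_abs[OF p] \<phi>(1)[OF qT] \<phi>_abs[OF qT], symmetric])
      also have "\<bar>\<dots>\<bar> \<le> 2 * (t / 2)"
        by (rule dev_bound[OF P N]) (use \<phi>(1)[OF p] \<phi>(1)[OF qT] q(2) in auto)
      finally have "X ?p w \<le> X (\<mu>, f) w + t" by linarith
      also have "X (\<mu>, f) w \<le> S w"
        unfolding S_def using T q(1) by (intro Max_ge) auto
      \<comment> \<open>The three copies of \<open>t\<close> pay for the passage to the net, the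
        fluctuation of \<open>S\<close> above its mean, and the fixed index
        \<open>ps\<close>.\<close>
      finally have "WRisk P \<alpha> (lhat w) - WRisk P \<alpha> ls \<le> m + 3 * t"
        using up down lw(2) w1 by linarith
      moreover have "(12 * J' + 24 * (\<Lambda> * ?D\<^sup>2)) / sqrt N \<le> (48 * J' + 48 * (\<Lambda> * ?D\<^sup>2)) / sqrt N"
        using J'0 \<Lambda>0 by (intro divide_right_mono add_mono mult_right_mono) auto
      ultimately show ?thesis
        using m ls(2) by linarith
    qed
    show ?thesis
      unfolding goal_eq using excess prob by (intro bexI[of _ ?A]) auto
  qed
qed

end
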